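(* Let $1\leq m<k\leq n$ be integers, let $\lambda_1,\ldots,\lambda_n>0$ and $\gamma>0$. Let $X_1,\ldots,X_n$ be independent exponential random variables with rates $\lambda_1,\ldots,\lambda_n$ respectively, and let $Y_1,\ldots,Y_n$ be independent exponential random variables with common rate $\gamma$. Let $X_{j:n}$ and $Y_{j:n}$ denote the $j$th order statistics of the two samples. Then $Y_{k:n}-Y_{m:n}\leq_* X_{k:n}-X_{m:n}$.
   Context: An exponential random variable with rate $\lambda>0$ has distribution function $1-e^{-\lambda x}$, $x\geq 0$. The $j$th order statistic of a sample of size $n$ is its $j$th smallest value (so $X_{1:n}$ is the minimum and $X_{n:n}$ the maximum). Star order: for random variables $U$ and $V$ supported on $(0,\infty)$ with distribution functions $F$ and $G$ respectively, $U\leq_* V$ means that $G^{-1}(F(x))/x$ is increasing (in the weak sense) in $x>0$, where $G^{-1}$ denotes the right continuous inverse of $G$. Equivalently, for each $c>0$, $F(cx)$ crosses $G(x)$ at most once, and from below, as $x$ increases on $(0,\infty)$. The order depends only on the distributions of $U$ and $V$. *)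

theory Defs
  imports "HOL-Probability.Probability"
begin

text \<open>The sample is indexed by \<open>{1..n}\<close>; for \<open>1 \<le> j \<le> n\<close>, \<open>order_stat n X j\<close> is the \<open>j\<close>th smallest
  value, counted with multiplicity. Outside this range the value is unspecified.\<close>

definition order_stat :: "nat \<Rightarrow> (nat \<Rightarrow> 'a \<Rightarrow> real) \<Rightarrow> nat \<Rightarrow> 'a \<Rightarrow> real" where
  "order_stat n X j \<omega> = sort (map (\<lambda>i. X i \<omega>) [1..<Suc n]) ! (j - 1)"

text \<open>The strict inequality makes this the right continuous version of the generalised inverse.
  It is extended-real valued because the set is empty when \<open>G\<close> never exceeds \<open>p\<close>
  (e.g. \<open>p = 1\<close>); the value is then \<open>\<infinity>\<close>.\<close>

definition right_inverse :: "(real \<Rightarrow> real) \<Rightarrow> real \<Rightarrow> ereal" where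
  "right_inverse G p = (INF x\<in>{x. p < G x}. ereal x)"

text \<open>Star order \<open>U \<le>\<^sub>* V\<close> for a random variable \<open>U\<close> on \<open>M\<close> and a random variable \<open>V\<close> on \<open>N\<close>;
  the two probability spaces may differ, as only the distributions matter. The order relates only
  random variables supported on the positive half-line.\<close>

definition star_order :: "'a measure \<Rightarrow> ('a \<Rightarrow> real) \<Rightarrow> 'b measure \<Rightarrow> ('b \<Rightarrow> real) \<Rightarrow> bool" where
  "star_order M U N V \<longleftrightarrow>
     U \<in> borel_measurable M \<and> V \<in> borel_measurable N \<and>
     (AE \<omega> in M. 0 < U \<omega>) \<and> (AE \<omega> in N. 0 < V \<omega>) \<and>
     mono_on {0<..}
       (\<lambda>x::real. right_inverse (cdf (distr N borel V)) (cdf (distr M borel U) x) / ereal x)"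

end

theory Submission
  imports Defs
begin

text \<open>
Write \<open>F\<close> for the distribution function of the \<open>k\<close>th order statistic of \<open>n\<close> independent standard
exponentials, so that rate \<open>\<gamma>\<close> gives \<open>x \<mapsto> F (\<gamma> x)\<close>. A distribution function \<open>G\<close> can be written
\<open>G x = F (v x * x)\<close>, and the star order asserts that \<open>v\<close> is decreasing: heterogeneity acts as a
common rate that slows down with time. \<open>star_below F G\<close> expresses this without inverses.

\<^bold>\<open>Reduction to order statistics.\<close> At the time of the \<open>m\<close>th failure, condition on which item fails
then and on the set \<open>B\<close> of items still alive. By lack of memory the residual lives of \<open>B\<close> are fresh
exponentials, so the spacing is distributed as a mixture over \<open>B\<close> of the \<open>(k - m)\<close>th order
statistics of the samples \<open>B\<close>, each of size \<open>n - m\<close> (\<open>prob_spacing_le\<close>). In the homogeneous sample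
all components coincide.

\<^bold>\<open>Mixtures.\<close> \<open>star_below F\<close> is closed under mixtures in its second argument
(\<open>star_below_mixture\<close>). The density \<open>f\<close> of \<open>F\<close> makes \<open>t \<mapsto> ln (f (exp t))\<close> concave, hence for \<open>s \<le> t\<close>
the map sending \<open>F (a * t)\<close> to \<open>F (a * s)\<close> is convex and lies above its supporting lines.

\<^bold>\<open>Order statistics.\<close> \<open>star_below_order_cdf\<close> is proved by induction on \<open>k\<close>. The minimum of the sample
is exponential with rate \<open>\<Lambda> = \<Sum>i. r i\<close> and independent of which item attains it. So
\<open>G' = \<Lambda> * (H - G)\<close>, where \<open>H\<close> is the mixture, with weights \<open>r i / \<Lambda>\<close>, of the \<open>(k - 1)\<close>st order
statistics of the samples with item \<open>i\<close> removed; and \<open>f = n * (F' - F)\<close>, where now \<open>F'\<close> denotes the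
distribution function belonging to \<open>(n - 1, k - 1)\<close>. By induction and closure under mixtures,
\<open>star_below F' H\<close>. Suppose \<open>G t = F (c * t)\<close>. Then \<open>E x = exp (\<Lambda> * x) * (G x - F (c * x))\<close> vanishes at
\<open>0\<close> and at \<open>t\<close>, and \<open>E'\<close> has the sign of
\<open>b x = \<Lambda> * (H x - F' (c * x)) + (\<Lambda> - n * c) * f (c * x) / n\<close>.
The mean bound \<open>G x \<le> F (\<Lambda> / n * x)\<close> (\<open>order_cdf_le_mean\<close>) gives \<open>c \<le> \<Lambda> / n\<close>, so the second summand is
nonnegative. Where \<open>H\<close> is below \<open>x \<mapsto> F' (c * x)\<close>, the deficit divided by \<open>f (c * x)\<close> increases with
\<open>x\<close> (\<open>iid_cdf_increment_ratio_mono\<close>). Hence \<open>b\<close> changes sign at most once, from plus to minus, so \<open>E\<close>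
first rises and then falls and is nonnegative on \<open>[0, t]\<close>. This is the required \<open>F (c * s) \<le> G s\<close>.
\<close>

section \<open>Poisson-binomial tails\<close>

text \<open>The probability that at least \<open>k\<close> of the independent events in \<open>S\<close> occur, event \<open>i\<close> having
  probability \<open>p i\<close>.\<close>

definition at_least :: "nat \<Rightarrow> 'i set \<Rightarrow> ('i \<Rightarrow> real) \<Rightarrow> real" where
  "at_least k S p = (\<Sum>T | T \<subseteq> S \<and> k \<le> card T. (\<Prod>i\<in>T. p i) * (\<Prod>i\<in>S - T. 1 - p i))"

lemma at_least_empty: "at_least k {} p = (if k = 0 then 1 else 0)"
proof -
  have "{T::'a set. T \<subseteq> {} \<and> k \<le> card T} = (if k = 0 then {{}} else {})" by auto
  then show ?thesis by (simp add: at_least_def)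
qed

text \<open>Condition on whether event \<open>j\<close> occurs. With truncated subtraction the recursion also covers
  \<open>k = 0\<close>, where all three tails equal \<open>1\<close>.\<close>

lemma at_least_insert:
  assumes S: "finite S" "j \<notin> S"
  shows "at_least k (insert j S) p = p j * at_least (k - 1) S p + (1 - p j) * at_least k S p"
proof -
  let ?A = "\<lambda>k. {T. T \<subseteq> S \<and> k \<le> card T}"
  let ?g = "\<lambda>T. (\<Prod>i\<in>T. p i) * (\<Prod>i\<in>insert j S - T. 1 - p i)"
  have fin: "finite (?A k)" for k using S(1) by simp
  have fT: "finite T" if "T \<subseteq> S" for T using that S(1) finite_subset by blast
  have split: "{T. T \<subseteq> insert j S \<and> k \<le> card T} = ?A k \<union> insert j ` ?A (k - 1)"
  proof (intro set_eqI iffI)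
    fix T assume T: "T \<in> {T. T \<subseteq> insert j S \<and> k \<le> card T}"
    show "T \<in> ?A k \<union> insert j ` ?A (k - 1)"
    proof (cases "j \<in> T")
      case True
      have "T - {j} \<subseteq> S" using T by auto
      moreover have "card (T - {j}) = card T - 1" using True by (rule card_Diff_singleton)
      ultimately have "T - {j} \<in> ?A (k - 1)" using T diff_le_mono by auto
      then have "insert j (T - {j}) \<in> insert j ` ?A (k - 1)" by (rule imageI)
      then show ?thesis using True by (simp add: insert_absorb)
    next
      case False
      then have "T \<in> ?A k" using T by (simp add: subset_insert)
      then show ?thesis by (rule UnI1)
    qed
  next
    fix T assume T: "T \<in> ?A k \<union> insert j ` ?A (k - 1)"
    then show "T \<in> {T. T \<subseteq> insert j S \<and> k \<le> card T}"
    proof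
      assume "T \<in> insert j ` ?A (k - 1)"
      then obtain U where U: "T = insert j U" "U \<subseteq> S" "k - 1 \<le> card U" by auto
      then have "card T = Suc (card U)" using S fT by (auto simp: card_insert_if)
      then show ?thesis using U by auto
    qed auto
  qed
  have "at_least k (insert j S) p = sum ?g (?A k) + sum ?g (insert j ` ?A (k - 1))"
    unfolding at_least_def split by (rule sum.union_disjoint) (use fin S in auto)
  also have "sum ?g (?A k) = (1 - p j) * at_least k S p"
    unfolding at_least_def sum_distrib_left
  proof (rule sum.cong[OF refl])
    fix T assume T: "T \<in> ?A k"
    then have "insert j S - T = insert j (S - T)" using S by auto
    then show "?g T = (1 - p j) * ((\<Prod>i\<in>T. p i) * (\<Prod>i\<in>S - T. 1 - p i))"
      using S by simp
  qed
  also have "sum ?g (insert j ` ?A (k - 1)) = sum (?g \<circ> insert j) (?A (k - 1))"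
    by (rule sum.reindex) (use S in \<open>auto simp: inj_on_def\<close>)
  also have "\<dots> = p j * at_least (k - 1) S p"
    unfolding at_least_def sum_distrib_left
  proof (rule sum.cong[OF refl])
    fix T assume T: "T \<in> ?A (k - 1)"
    then have "insert j S - insert j T = S - T" "j \<notin> T" "finite T" using S fT by auto
    then show "(?g \<circ> insert j) T = p j * ((\<Prod>i\<in>T. p i) * (\<Prod>i\<in>S - T. 1 - p i))"
      by simp
  qed
  finally show ?thesis by simp
qed

lemma at_least_0: "finite S \<Longrightarrow> at_least 0 S p = 1"
  by (induction S rule: finite_induct) (simp_all add: at_least_empty at_least_insert)

lemma at_least_cong: "(\<And>i. i \<in> S \<Longrightarrow> p i = q i) \<Longrightarrow> at_least k S p = at_least k S q"
  unfolding at_least_def by (intro sum.cong refl arg_cong2[where f="(*)"] prod.cong) auto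

lemma at_least_antimono:
  assumes "finite S" "\<And>i. i \<in> S \<Longrightarrow> 0 \<le> p i \<and> p i \<le> 1" "j \<le> k"
  shows "at_least k S p \<le> at_least j S p"
  unfolding at_least_def using assms
  by (intro sum_mono2) (auto intro!: mult_nonneg_nonneg prod_nonneg)

lemma at_least_nonneg:
  assumes "\<And>i. i \<in> S \<Longrightarrow> 0 \<le> p i \<and> p i \<le> 1"
  shows "0 \<le> at_least k S p"
  unfolding at_least_def using assms
  by (intro sum_nonneg) (auto intro!: mult_nonneg_nonneg prod_nonneg)

section \<open>Order statistics of heterogeneous and homogeneous exponential samples\<close>

text \<open>The distribution function at \<open>x \<ge> 0\<close> of the \<open>k\<close>th order statistic of independent exponentials with
  rates \<open>r i\<close>, \<open>i \<in> S\<close>: at least \<open>k\<close> of them have occurred by time \<open>x\<close>.\<close>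

definition order_cdf :: "('i \<Rightarrow> real) \<Rightarrow> nat \<Rightarrow> 'i set \<Rightarrow> real \<Rightarrow> real" where
  "order_cdf r k S x = at_least k S (\<lambda>i. 1 - exp (- (r i * x)))"

lemma order_cdf_insert:
  assumes "finite S" "j \<notin> S"
  shows "order_cdf r k (insert j S) x =
    (1 - exp (- (r j * x))) * order_cdf r (k - 1) S x + exp (- (r j * x)) * order_cdf r k S x"
  unfolding order_cdf_def at_least_insert[OF assms] by simp

lemma order_cdf_zero: "finite S \<Longrightarrow> order_cdf r k S 0 = (if k = 0 then 1 else 0)"
  by (induction S arbitrary: k rule: finite_induct)
    (auto simp: order_cdf_insert order_cdf_def[of _ _ "{}"] at_least_empty)

text \<open>The minimum is exponential with rate \<open>\<Sum>i\<in>S. r i\<close> and is attained by item \<open>i\<close> with probability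
  proportional to \<open>r i\<close>, after which the \<open>(k - 1)\<close>st order statistic of the other items is awaited.
  Differentiating the resulting convolution gives this equation; algebraically it follows from the
  recursion \<open>order_cdf_insert\<close>.\<close>

lemma DERIV_order_cdf:
  assumes "finite S"
  shows "(order_cdf r k S has_real_derivative
    (\<Sum>i\<in>S. r i * (order_cdf r (k - 1) (S - {i}) x - order_cdf r k S x))) (at x)"
  using assms
proof (induction S arbitrary: k rule: finite_induct)
  case empty
  have "order_cdf r k {} = (\<lambda>_. if k = 0 then 1 else 0)"
    by (auto simp: order_cdf_def at_least_empty)
  then show ?case by simp
next
  case (insert j S)
  define e where "e = exp (- (r j * x))"
  define G where "G k = order_cdf r k S x" for k
  define G' where "G' i k = order_cdf r k (S - {i}) x" for i k
  have fn: "order_cdf r k (insert j S) = (\<lambda>x. (1 - exp (- (r j * x))) * order_cdf r (k - 1) S x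
      + exp (- (r j * x)) * order_cdf r k S x)"
    using order_cdf_insert[OF insert.hyps] by blast
  have exp_deriv: "((\<lambda>x. exp (- (r j * x))) has_real_derivative - r j * e) (at x)"
    unfolding e_def by (auto intro!: derivative_eq_intros)
  have deriv: "(order_cdf r k (insert j S) has_real_derivative
      ((0 - - r j * e) * G (k - 1)
        + (\<Sum>i\<in>S. r i * (G' i (k - 1 - 1) - G (k - 1))) * (1 - e))
      + (- r j * e * G k + (\<Sum>i\<in>S. r i * (G' i (k - 1) - G k)) * e)) (at x)"
    unfolding fn G_def G'_def
    using DERIV_add[OF
        DERIV_mult[OF DERIV_diff[OF DERIV_const exp_deriv] insert.IH[of "k - 1"]]
        DERIV_mult[OF exp_deriv insert.IH[of k]]]
    unfolding e_def by simp
  have "order_cdf r (k - 1) (insert j S - {i}) x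
      = (1 - e) * G' i (k - 1 - 1) + e * G' i (k - 1)" if "i \<in> S" for i
  proof -
    have "insert j S - {i} = insert j (S - {i})" using that insert.hyps by auto
    then show ?thesis using insert.hyps by (simp add: order_cdf_insert e_def G'_def)
  qed
  moreover have "insert j S - {j} = S" using insert.hyps by auto
  moreover have "order_cdf r k (insert j S) x = (1 - e) * G (k - 1) + e * G k"
    using insert.hyps by (simp add: order_cdf_insert e_def G_def)
  moreover have "order_cdf r (k - 1) (insert j S - {j}) x = G (k - 1)"
    using insert.hyps by (simp add: G_def)
  ultimately have "(\<Sum>i\<in>insert j S. r i *
      (order_cdf r (k - 1) (insert j S - {i}) x - order_cdf r k (insert j S) x))
    = r j * (G (k - 1) - ((1 - e) * G (k - 1) + e * G k))
      + (\<Sum>i\<in>S. r i * ((1 - e) * G' i (k - 1 - 1) + e * G' i (k - 1)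
          - ((1 - e) * G (k - 1) + e * G k)))"
    using insert.hyps(1,2) by (simp cong: sum.cong)
  also have "(\<Sum>i\<in>S. r i * ((1 - e) * G' i (k - 1 - 1) + e * G' i (k - 1)
          - ((1 - e) * G (k - 1) + e * G k)))
      = (\<Sum>i\<in>S. r i * (G' i (k - 1 - 1) - G (k - 1))) * (1 - e)
        + (\<Sum>i\<in>S. r i * (G' i (k - 1) - G k)) * e"
    unfolding sum_distrib_right sum.distrib[symmetric]
    by (intro sum.cong refl) (simp add: algebra_simps)
  finally show ?case
    using deriv by (elim DERIV_cong) (simp add: algebra_simps)
qed

definition iid_cdf :: "nat \<Rightarrow> nat \<Rightarrow> real \<Rightarrow> real" where
  "iid_cdf n k = order_cdf (\<lambda>_. 1) k {..<n}"

lemma iid_cdf_Suc: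
  "iid_cdf (Suc n) k y = (1 - exp (- y)) * iid_cdf n (k - 1) y + exp (- y) * iid_cdf n k y"
  by (simp add: iid_cdf_def lessThan_Suc order_cdf_insert)

lemma order_cdf_const:
  "finite S \<Longrightarrow> order_cdf (\<lambda>_. c) k S x = iid_cdf (card S) k (c * x)"
proof (induction S arbitrary: k rule: finite_induct)
  case empty
  then show ?case by (simp add: iid_cdf_def order_cdf_def at_least_empty)
next
  case (insert j S)
  then show ?case by (simp add: order_cdf_insert iid_cdf_Suc)
qed

lemma iid_cdf_0: "iid_cdf n 0 y = 1"
  by (simp add: iid_cdf_def order_cdf_def at_least_0)

lemma iid_cdf_diff:
  "iid_cdf n k y - iid_cdf n (Suc k) y = real (n choose k) * (1 - exp (- y)) ^ k * exp (- y) ^ (n - k)"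
proof (induction n arbitrary: k)
  case 0
  show ?case by (cases k) (simp_all add: iid_cdf_def order_cdf_def at_least_empty)
next
  case (Suc n)
  show ?case
  proof (cases k)
    case 0
    have "iid_cdf (Suc n) 0 y - iid_cdf (Suc n) (Suc 0) y
        = exp (- y) * (iid_cdf n 0 y - iid_cdf n (Suc 0) y)"
      by (simp add: iid_cdf_Suc iid_cdf_0 algebra_simps)
    then show ?thesis using Suc.IH[of 0] 0 by simp
  next
    case (Suc l)
    define p q where "p = 1 - exp (- y)" and "q = exp (- y)"
    have "iid_cdf (Suc n) (Suc l) y - iid_cdf (Suc n) (Suc (Suc l)) y
        = p * (iid_cdf n l y - iid_cdf n (Suc l) y)
          + q * (iid_cdf n (Suc l) y - iid_cdf n (Suc (Suc l)) y)"
      by (simp add: iid_cdf_Suc p_def q_def algebra_simps)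
    also have "\<dots> = p * (real (n choose l) * p ^ l * q ^ (n - l))
          + q * (real (n choose Suc l) * p ^ Suc l * q ^ (n - Suc l))"
      unfolding Suc.IH p_def q_def ..
    also have "q * (real (n choose Suc l) * p ^ Suc l * q ^ (n - Suc l))
        = real (n choose Suc l) * p ^ Suc l * q ^ (n - l)"
    proof (cases "l < n")
      case True
      then have "n - l = Suc (n - Suc l)" by simp
      then show ?thesis by simp
    qed simp
    finally show ?thesis using Suc by (simp add: p_def q_def algebra_simps)
  qed
qed

text \<open>The density belonging to \<open>iid_cdf (Suc n) (Suc k)\<close>. The shift of both indices keeps natural number
  subtraction exact as long as \<open>k \<le> n\<close>.\<close>

definition iid_density :: "nat \<Rightarrow> nat \<Rightarrow> real \<Rightarrow> real" where
  "iid_density n k y =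
    real (Suc n) * real (n choose k) * (1 - exp (- y)) ^ k * exp (- y) ^ Suc (n - k)"

lemma iid_density_eq:
  "iid_density n k y = real (Suc n) * (iid_cdf n k y - iid_cdf (Suc n) (Suc k) y)"
proof -
  have "iid_cdf n k y - iid_cdf (Suc n) (Suc k) y
      = exp (- y) * (iid_cdf n k y - iid_cdf n (Suc k) y)"
    by (simp add: iid_cdf_Suc algebra_simps)
  then show ?thesis by (simp add: iid_cdf_diff iid_density_def)
qed

lemma DERIV_iid_cdf:
  "(iid_cdf (Suc n) (Suc k) has_real_derivative iid_density n k y) (at y)"
proof -
  have "order_cdf (\<lambda>_. 1) k ({..<Suc n} - {i}) y = iid_cdf n k y" if "i < Suc n" for i
    using that by (subst order_cdf_const) (auto simp: card_Diff_singleton)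
  then show ?thesis
    using DERIV_order_cdf[of "{..<Suc n}" "\<lambda>_. 1" "Suc k" y]
    by (simp add: iid_cdf_def[symmetric] iid_density_eq)
qed

lemma iid_density_pos: "k \<le> n \<Longrightarrow> 0 < y \<Longrightarrow> 0 < iid_density n k y"
  by (simp add: iid_density_def)

section \<open>Comparison with the sample of average rate\<close>

text \<open>The tail as an affine function of the sum and of the product of the two complementary
  probabilities \<open>1 - p i\<close> and \<open>1 - p j\<close>.\<close>

lemma at_least_insert2:
  assumes "finite S" "i \<notin> S" "j \<notin> S" "i \<noteq> j"
  shows "at_least k (insert i (insert j S)) p =
    at_least (k - 1 - 1) S p
    - (1 - p i + (1 - p j)) * (at_least (k - 1 - 1) S p - at_least (k - 1) S p)
    + (1 - p i) * (1 - p j) *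
        (at_least (k - 1 - 1) S p - 2 * at_least (k - 1) S p + at_least k S p)"
  using assms by (simp add: at_least_insert algebra_simps)

text \<open>Smoothing: while the \<open>a i\<close> are not all equal to their mean \<open>\<mu>\<close>, replace one value below and one value
  above \<open>\<mu>\<close> by \<open>\<mu>\<close> and by the value that preserves their sum. The product of the two
  complementary probabilities is unchanged and their sum decreases, so by \<open>at_least_insert2\<close> the tail increases; one
  more entry now equals \<open>\<mu>\<close>.\<close>

lemma at_least_exp_le_mean:
  assumes "finite S" "\<And>i. i \<in> S \<Longrightarrow> 0 \<le> a i" "(\<Sum>i\<in>S. a i) = real (card S) * \<mu>"
  shows "at_least k S (\<lambda>i. 1 - exp (- a i)) \<le> at_least k S (\<lambda>_. 1 - exp (- \<mu>))"
  using assms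
proof (induction "card {i \<in> S. a i \<noteq> \<mu>}" arbitrary: a rule: less_induct)
  case less
  show ?case
  proof (cases "\<forall>i\<in>S. a i = \<mu>")
    case True
    then show ?thesis by (intro eq_refl at_least_cong) simp
  next
    case False
    have dev: "(\<Sum>i\<in>S. a i - \<mu>) = 0" using less.prems by (simp add: sum_subtractf)
    have "\<exists>i\<in>S. a i < \<mu>"
    proof (rule ccontr)
      assume "\<not> ?thesis"
      then have "\<forall>i\<in>S. 0 \<le> a i - \<mu>" by auto
      then show False using dev False sum_nonneg_eq_0_iff[OF less.prems(1), of "\<lambda>i. a i - \<mu>"] by auto
    qed
    then obtain i where i: "i \<in> S" "a i < \<mu>" by blast
    have "\<exists>j\<in>S. \<mu> < a j"
    proof (rule ccontr)
      assume "\<not> ?thesis"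
      then have "\<forall>i\<in>S. 0 \<le> \<mu> - a i" by auto
      moreover have "(\<Sum>i\<in>S. \<mu> - a i) = 0" using less.prems by (simp add: sum_subtractf)
      ultimately show False
        using False sum_nonneg_eq_0_iff[OF less.prems(1), of "\<lambda>i. \<mu> - a i"] by auto
    qed
    then obtain j where j: "j \<in> S" "\<mu> < a j" by blast
    have ij: "i \<noteq> j" using i j by auto
    \<comment> \<open>The smoothed values: \<open>u\<close> and \<open>v\<close> become \<open>w\<close> and \<open>u * v / w\<close>, with the same product.\<close>
    define b where "b = a(i := \<mu>, j := a i + a j - \<mu>)"
    define R where "R = S - {i, j}"
    have S: "S = insert i (insert j R)" and R: "finite R" "i \<notin> R" "j \<notin> R"
      using i j less.prems(1) by (auto simp: R_def)
    have bR: "b l = a l" if "l \<in> R" for l using that R by (auto simp: b_def)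
    define L where "L k = at_least k R (\<lambda>i. 1 - exp (- a i))" for k
    have L: "at_least k R (\<lambda>i. 1 - exp (- b i)) = L k" for k
      unfolding L_def by (rule at_least_cong) (simp add: bR)
    define u v w where "u = exp (- a i)" and "v = exp (- a j)" and "w = exp (- \<mu>)"
    have w: "0 < w" "v < w" "w < u" using i j by (simp_all add: u_def v_def w_def)
    have bi: "exp (- b i) = w" and bj: "exp (- b j) = u * v / w"
      using ij by (simp_all add: b_def u_def v_def w_def exp_minus exp_diff exp_add field_simps)
    have "u + v - (w + u * v / w) = (u - w) * (w - v) / w"
      using w by (simp add: field_simps)
    moreover have "0 \<le> (u - w) * (w - v) / w" using w by simp
    ultimately have sum_le: "w + u * v / w \<le> u + v" by linarith
    have mono: "L (k - 1) \<le> L (k - 1 - 1)"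
      unfolding L_def using R less.prems(2) S by (intro at_least_antimono) auto
    have "at_least k S (\<lambda>i. 1 - exp (- a i)) =
        L (k - 1 - 1) - (u + v) * (L (k - 1 - 1) - L (k - 1))
        + u * v * (L (k - 1 - 1) - 2 * L (k - 1) + L k)"
      unfolding S at_least_insert2[OF R ij] by (simp add: L_def u_def v_def)
    also have "\<dots> \<le> L (k - 1 - 1) - (w + u * v / w) * (L (k - 1 - 1) - L (k - 1))
        + w * (u * v / w) * (L (k - 1 - 1) - 2 * L (k - 1) + L k)"
      using mult_right_mono[OF sum_le, of "L (k - 1 - 1) - L (k - 1)"] mono w by simp
    also have "\<dots> = at_least k S (\<lambda>i. 1 - exp (- b i))"
      unfolding S at_least_insert2[OF R ij] by (simp add: L bi bj)
    also have "\<dots> \<le> at_least k S (\<lambda>_. 1 - exp (- \<mu>))"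
    proof (rule less.hyps)
      have "{l \<in> S. b l \<noteq> \<mu>} \<subseteq> {l \<in> S. a l \<noteq> \<mu>} - {i}"
        using i j by (auto simp: b_def)
      also have "\<dots> \<subset> {l \<in> S. a l \<noteq> \<mu>}" using i by auto
      finally show "card {l \<in> S. b l \<noteq> \<mu>} < card {l \<in> S. a l \<noteq> \<mu>}"
        using less.prems(1) by (intro psubset_card_mono) auto
      show "finite S" by fact
      show "0 \<le> b l" if "l \<in> S" for l
        using that i j less.prems(2)[of l] less.prems(2)[of i] by (auto simp: b_def)
      have "(\<Sum>l\<in>S. b l) = b i + b j + (\<Sum>l\<in>R. b l)" unfolding S using R ij by simp
      also have "\<dots> = a i + a j + (\<Sum>l\<in>R. a l)" using bR ij by (simp add: b_def)
      also have "\<dots> = (\<Sum>l\<in>S. a l)" unfolding S using R ij by simp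
      finally show "(\<Sum>l\<in>S. b l) = real (card S) * \<mu>" using less.prems(3) by simp
    qed
    finally show ?thesis .
  qed
qed

lemma order_cdf_le_mean:
  assumes "finite S" "S \<noteq> {}" "\<And>i. i \<in> S \<Longrightarrow> 0 < r i" "0 \<le> x"
  shows "order_cdf r k S x \<le> iid_cdf (card S) k ((\<Sum>i\<in>S. r i) / real (card S) * x)"
proof -
  let ?c = "(\<Sum>i\<in>S. r i) / real (card S)"
  have "order_cdf r k S x \<le> at_least k S (\<lambda>_. 1 - exp (- (?c * x)))"
    unfolding order_cdf_def
    by (rule at_least_exp_le_mean) (use assms in \<open>auto simp: sum_distrib_right less_imp_le\<close>)
  also have "\<dots> = iid_cdf (card S) k (?c * x)"
    using order_cdf_const[OF assms(1), of ?c k x] by (simp add: order_cdf_def)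
  finally show ?thesis .
qed

section \<open>Monotonicity properties of the homogeneous densities\<close>

lemma exp_chord:
  fixes x :: real
  assumes "0 \<le> \<theta>" "\<theta> \<le> 1"
  shows "exp (\<theta> * x) \<le> 1 - \<theta> + \<theta> * exp x"
  using convex_onD[OF exp_convex, of \<theta> 0 x] assms by simp

text \<open>\<open>1 - exp (- c * x)\<close> is concave in \<open>x\<close> and vanishes at \<open>0\<close>, so its ratio to \<open>x\<close> decreases.\<close>

lemma exp_cdf_chord:
  fixes s t c :: real
  assumes "0 < s" "s \<le> t"
  shows "s * (1 - exp (- (c * t))) \<le> t * (1 - exp (- (c * s)))"
proof -
  have "exp ((s / t) * (- (c * t))) \<le> 1 - s / t + s / t * exp (- (c * t))"
    using assms by (intro exp_chord) auto
  then have "t * exp (- (c * s)) \<le> t * (1 - s / t + s / t * exp (- (c * t)))"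
    using assms by (intro mult_left_mono) (auto simp: field_simps)
  also have "\<dots> = t - s + s * exp (- (c * t))" using assms by (simp add: field_simps)
  finally show ?thesis by (simp add: algebra_simps)
qed

text \<open>The ratio \<open>(1 - exp (- x * s)) / (1 - exp (- x * t))\<close> increases in \<open>x\<close>: the sign of its derivative is that
  of \<open>(exp (x * t) - 1) / t - (exp (x * s) - 1) / s\<close>, which is nonnegative by convexity of \<open>exp\<close>.\<close>

lemma exp_cdf_sub_multiplicative:
  fixes a c s t :: real
  assumes "0 < a" "a \<le> c" "0 < s" "s \<le> t"
  shows "(1 - exp (- (a * s))) * (1 - exp (- (c * t))) \<le> (1 - exp (- (a * t))) * (1 - exp (- (c * s)))"
proof -
  let ?\<rho> = "\<lambda>x. (1 - exp (- (x * s))) / (1 - exp (- (x * t)))"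
  have "?\<rho> a \<le> ?\<rho> c"
  proof (rule DERIV_nonneg_imp_nondecreasing[OF assms(2)])
    fix x assume x: "a \<le> x" "x \<le> c"
    then have xpos: "0 < x" using assms by simp
    have pos: "0 < 1 - exp (- (x * t))" using xpos assms by simp
    have der: "(?\<rho> has_real_derivative
        (s * exp (- (x * s)) * (1 - exp (- (x * t))) - (1 - exp (- (x * s))) * (t * exp (- (x * t))))
        / ((1 - exp (- (x * t))) * (1 - exp (- (x * t))))) (at x)"
      using pos by (auto intro!: derivative_eq_intros)
    have "exp ((s / t) * (x * t)) \<le> 1 - s / t + s / t * exp (x * t)"
      using assms by (intro exp_chord) auto
    then have "t * exp (x * s) \<le> t * (1 - s / t + s / t * exp (x * t))"
      using assms by (intro mult_left_mono) (auto simp: field_simps)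
    also have "\<dots> = t - s + s * exp (x * t)" using assms by (simp add: field_simps)
    finally have "t * (exp (x * s) - 1) \<le> s * (exp (x * t) - 1)" by (simp add: algebra_simps)
    then have "exp (- (x * s)) * exp (- (x * t)) * (t * (exp (x * s) - 1))
        \<le> exp (- (x * s)) * exp (- (x * t)) * (s * (exp (x * t) - 1))"
      by (intro mult_left_mono) auto
    then have "(1 - exp (- (x * s))) * (t * exp (- (x * t)))
        \<le> s * exp (- (x * s)) * (1 - exp (- (x * t)))"
      by (simp add: exp_minus field_simps)
    then show "\<exists>y. (?\<rho> has_real_derivative y) (at x) \<and> 0 \<le> y"
      using der pos by (meson diff_ge_0_iff_ge divide_nonneg_pos mult_pos_pos)
  qed
  then show ?thesis using assms by (simp add: field_simps)
qed

text \<open>Equivalent to log-concavity of \<open>x \<mapsto> f (exp x)\<close>; it holds for each factor of the density separately.\<close>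

lemma iid_density_sub_multiplicative:
  assumes "0 < a" "a \<le> c" "0 < s" "s \<le> t"
  shows "iid_density n k (a * s) * iid_density n k (c * t)
    \<le> iid_density n k (a * t) * iid_density n k (c * s)"
proof -
  let ?p = "\<lambda>y::real. 1 - exp (- y)" and ?q = "\<lambda>y::real. exp (- y)"
  have st: "0 < t" "0 < c" using assms by auto
  have "0 \<le> (c - a) * (t - s)" using assms by simp
  then have q: "?q (a * s) * ?q (c * t) \<le> ?q (a * t) * ?q (c * s)"
    by (simp add: exp_add[symmetric] algebra_simps)
  have "(?p (a * s) * ?p (c * t)) ^ k * (?q (a * s) * ?q (c * t)) ^ Suc (n - k)
      \<le> (?p (a * t) * ?p (c * s)) ^ k * (?q (a * t) * ?q (c * s)) ^ Suc (n - k)"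
    by (rule mult_mono[OF power_mono[OF exp_cdf_sub_multiplicative[OF assms]] power_mono[OF q]])
      (use assms st in auto)
  then have "(real (Suc n) * real (n choose k)) ^ 2
        * ((?p (a * s) * ?p (c * t)) ^ k * (?q (a * s) * ?q (c * t)) ^ Suc (n - k))
      \<le> (real (Suc n) * real (n choose k)) ^ 2
        * ((?p (a * t) * ?p (c * s)) ^ k * (?q (a * t) * ?q (c * s)) ^ Suc (n - k))"
    by (rule mult_left_mono) simp
  then show ?thesis
    unfolding iid_density_def power_mult_distrib power2_eq_square by (simp only: mult_ac)
qed

text \<open>\<open>x * iid_density n k (a * x) / iid_density (Suc n) (Suc k) (c * x)\<close> increases in \<open>x\<close>. The two densities
  differ by a constant and one factor \<open>1 - exp (- y)\<close>, so the quotient gains the increasing factor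
  \<open>x / (1 - exp (- c * x))\<close>.\<close>

lemma iid_density_Suc_sub_multiplicative:
  assumes "0 < a" "a \<le> c" "0 < s" "s \<le> t"
  shows "s * iid_density n k (a * s) * iid_density (Suc n) (Suc k) (c * t)
    \<le> t * iid_density n k (a * t) * iid_density (Suc n) (Suc k) (c * s)"
proof -
  let ?p = "\<lambda>y::real. 1 - exp (- y)"
  have st: "0 < t" "0 < c" using assms by auto
  define C where "C = real (Suc (Suc n)) * real (Suc n choose Suc k)"
  define D where "D = real (Suc n) * real (n choose k)"
  have CD: "0 \<le> C" "0 \<le> D" by (auto simp: C_def D_def)
  have split: "D * iid_density (Suc n) (Suc k) y = C * (iid_density n k y * ?p y)" for y
    unfolding iid_density_def C_def D_def by simp
  have "(iid_density n k (a * s) * iid_density n k (c * t)) * (s * ?p (c * t))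
      \<le> (iid_density n k (a * t) * iid_density n k (c * s)) * (t * ?p (c * s))"
    by (rule mult_mono[OF iid_density_sub_multiplicative[OF assms] exp_cdf_chord[OF assms(3,4)]])
      (use assms st in \<open>auto simp: iid_density_def\<close>)
  then have le: "C * ((iid_density n k (a * s) * iid_density n k (c * t)) * (s * ?p (c * t)))
      \<le> C * ((iid_density n k (a * t) * iid_density n k (c * s)) * (t * ?p (c * s)))"
    by (rule mult_left_mono) fact
  have "D * (s * iid_density n k (a * s) * iid_density (Suc n) (Suc k) (c * t))
      \<le> D * (t * iid_density n k (a * t) * iid_density (Suc n) (Suc k) (c * s))"
  proof -
    have "D * (s * iid_density n k (a * s) * iid_density (Suc n) (Suc k) (c * t))
        = s * iid_density n k (a * s) * (C * (iid_density n k (c * t) * ?p (c * t)))"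
      unfolding split[symmetric] by (simp only: mult_ac)
    moreover have "D * (t * iid_density n k (a * t) * iid_density (Suc n) (Suc k) (c * s))
        = t * iid_density n k (a * t) * (C * (iid_density n k (c * s) * ?p (c * s)))"
      unfolding split[symmetric] by (simp only: mult_ac)
    ultimately show ?thesis using le by (simp only: mult_ac)
  qed
  then show ?thesis
  proof (cases "k \<le> n")
    case True
    then have "0 < D" by (simp add: D_def)
    then show ?thesis
      using \<open>D * _ \<le> D * _\<close> by (simp only: mult_le_cancel_left_pos)
  next
    case False
    then show ?thesis by (simp add: iid_density_def binomial_eq_0)
  qed
qed

section \<open>A star order for distribution functions, closed under mixtures\<close>

text \<open>For strictly increasing \<open>F\<close> the number \<open>a\<close> is the value at \<open>t\<close> of the function \<open>v\<close> with \<open>G x = F (v x * x)\<close>,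
  and the inequality says \<open>v t \<le> v s\<close>. This form needs no inverse of \<open>F\<close> and also provides
  the existence of \<open>v\<close>.\<close>

definition star_below :: "(real \<Rightarrow> real) \<Rightarrow> (real \<Rightarrow> real) \<Rightarrow> bool" where
  "star_below F G \<longleftrightarrow>
    (\<forall>t>0. \<exists>a\<ge>0. G t = F (a * t) \<and> (\<forall>s. 0 < s \<and> s \<le> t \<longrightarrow> F (a * s) \<le> G s))"

lemma star_belowE:
  assumes "star_below F G" "0 < t"
  obtains a where "0 \<le> a" "G t = F (a * t)" "\<And>s. 0 < s \<Longrightarrow> s \<le> t \<Longrightarrow> F (a * s) \<le> G s"
  using assms unfolding star_below_def by blast

lemma pos_density_mono:
  assumes deriv: "\<And>y. (F has_real_derivative f y) (at y)" and pos: "\<And>y. 0 < y \<Longrightarrow> 0 < f y"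
    and "0 \<le> a" "a \<le> b"
  shows "F a \<le> (F b :: real)"
proof (rule DERIV_nonneg_imp_increasing_open[OF assms(4)])
  show "\<exists>y. (F has_real_derivative y) (at x) \<and> 0 \<le> y" if "a < x" "x < b" for x
    using deriv[of x] pos[of x] that assms(3) by (auto intro!: exI[of _ "f x"])
  show "continuous_on {a..b} F"
    by (intro continuous_at_imp_continuous_on ballI DERIV_isCont[OF deriv])
qed

lemma pos_density_strict_mono:
  assumes deriv: "\<And>y. (F has_real_derivative f y) (at y)" and pos: "\<And>y. 0 < y \<Longrightarrow> 0 < f y"
    and "0 \<le> a" "a < b"
  shows "F a < (F b :: real)"
proof (rule DERIV_pos_imp_increasing_open[OF assms(4)])
  show "\<exists>y. (F has_real_derivative y) (at x) \<and> 0 < y" if "a < x" "x < b" for x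
    using deriv[of x] pos[of x] that assms(3) by (auto intro!: exI[of _ "f x"])
  show "continuous_on {a..b} F"
    by (intro continuous_at_imp_continuous_on ballI DERIV_isCont[OF deriv])
qed

text \<open>Intermediate values along \<open>c \<mapsto> F (c * t)\<close>; the upper bound \<open>A\<close> for \<open>c\<close> is kept, as it later bounds the
  rate matched at \<open>t\<close> by the average rate.\<close>

lemma rescaling_value:
  fixes F :: "real \<Rightarrow> real"
  assumes deriv: "\<And>y. (F has_real_derivative f y) (at y)"
    and "0 \<le> A" "F 0 \<le> p" "p \<le> F (A * t)"
  obtains c where "0 \<le> c" "c \<le> A" "F (c * t) = p"
proof -
  have "continuous_on {0..A} (\<lambda>c. F (c * t))"
    by (intro continuous_at_imp_continuous_on ballI isCont_o2[where f="\<lambda>c. c * t" and g=F]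
        DERIV_isCont[OF deriv] continuous_intros)
  then show thesis using IVT'[of "\<lambda>c. F (c * t)" 0 p A] assms that by auto
qed

text \<open>For \<open>s \<le> t\<close> the value \<open>F (a * s)\<close> is a convex function of \<open>F (a * t)\<close>, because \<open>f (a * s) / f (a * t)\<close> increases
  in \<open>a\<close>. The inequality is its supporting line at \<open>a = c\<close>.\<close>

lemma scaled_supporting_line:
  assumes deriv: "\<And>y. (F has_real_derivative f y) (at y)" and pos: "\<And>y. 0 < y \<Longrightarrow> 0 < f y"
    and sub: "\<And>a c s t. 0 < a \<Longrightarrow> a \<le> c \<Longrightarrow> 0 < s \<Longrightarrow> s \<le> t \<Longrightarrow>
      f (a * s) * f (c * t) \<le> f (a * t) * f (c * s)"
    and "0 \<le> a" "0 < c" "0 < s" "s \<le> t"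
  shows "(s * f (c * s)) / (t * f (c * t)) * (F (a * t) - F (c * t)) \<le> F (a * s) - (F (c * s) :: real)"
proof -
  define \<kappa> where "\<kappa> = (s * f (c * s)) / (t * f (c * t))"
  \<comment> \<open>The claim is that \<open>\<psi>\<close> attains its minimum at \<open>c\<close>; its derivative changes sign there.\<close>
  let ?\<psi> = "\<lambda>x. F (x * s) - \<kappa> * F (x * t)"
  have t: "0 < t" "0 < f (c * t)" using assms by auto
  have der: "(?\<psi> has_real_derivative (s * f (x * s) - \<kappa> * (t * f (x * t)))) (at x)" for x
  proof -
    have "((\<lambda>x. F (x * u)) has_real_derivative f (x * u) * u) (at x)" for u
      by (rule DERIV_chain2[OF deriv]) (auto intro!: derivative_eq_intros)
    from DERIV_diff[OF this[of s] DERIV_cmult[OF this[of t], of \<kappa>]]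
    show ?thesis by (simp add: mult_ac)
  qed
  have cont: "continuous_on X ?\<psi>" for X
    by (intro continuous_at_imp_continuous_on ballI DERIV_isCont[OF der])
  have "?\<psi> c \<le> ?\<psi> a"
  proof (cases "a \<le> c")
    case True
    show ?thesis
    proof (rule DERIV_nonpos_imp_decreasing_open[OF True _ cont])
      fix x assume x: "a < x" "x < c"
      then have "f (x * s) * f (c * t) \<le> f (x * t) * f (c * s)" using assms by (intro sub) auto
      then have "s * f (x * s) \<le> \<kappa> * (t * f (x * t))"
        using t assms by (simp add: \<kappa>_def field_simps)
      then show "\<exists>y. (?\<psi> has_real_derivative y) (at x) \<and> y \<le> 0" using der[of x] by force
    qed
  next
    case False
    then have "c \<le> a" by simp
    then show ?thesis
    proof (rule DERIV_nonneg_imp_increasing_open[OF _ _ cont])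
      fix x assume x: "c < x" "x < a"
      then have "f (c * s) * f (x * t) \<le> f (c * t) * f (x * s)" using assms by (intro sub) auto
      then have "\<kappa> * (t * f (x * t)) \<le> s * f (x * s)"
        using t assms by (simp add: \<kappa>_def field_simps)
      then show "\<exists>y. (?\<psi> has_real_derivative y) (at x) \<and> 0 \<le> y" using der[of x] by force
    qed
  qed
  then show ?thesis unfolding \<kappa>_def[symmetric] by (simp add: algebra_simps)
qed

text \<open>Let \<open>c\<close> match the mixture at \<open>t\<close> and \<open>a i\<close> the components. Averaging the supporting line at \<open>c\<close> over the
  \<open>a i\<close>, its linear part cancels and \<open>F (c * s)\<close> is at most the average of the \<open>F (a i * s)\<close>.\<close>

lemma star_below_mixture:
  assumes deriv: "\<And>y. (F has_real_derivative f y) (at y)" and pos: "\<And>y. 0 < y \<Longrightarrow> 0 < f y"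
    and sub: "\<And>a c s t. 0 < a \<Longrightarrow> a \<le> c \<Longrightarrow> 0 < s \<Longrightarrow> s \<le> t \<Longrightarrow>
      f (a * s) * f (c * t) \<le> f (a * t) * f (c * s)"
    and I: "finite I" "\<And>i. i \<in> I \<Longrightarrow> 0 \<le> w i" "(\<Sum>i\<in>I. w i) = 1"
    and G: "\<And>i. i \<in> I \<Longrightarrow> star_below F (G i)"
  shows "star_below F (\<lambda>x. \<Sum>i\<in>I. w i * G i x)"
  unfolding star_below_def
proof (intro allI impI)
  fix t :: real assume t: "0 < t"
  note mono = pos_density_mono[of F f, OF deriv pos]
  have "\<forall>i\<in>I. \<exists>a\<ge>0. G i t = F (a * t) \<and> (\<forall>s. 0 < s \<and> s \<le> t \<longrightarrow> F (a * s) \<le> G i s)"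
    using G t by (auto simp: star_below_def)
  then obtain a where a: "\<And>i. i \<in> I \<Longrightarrow> 0 \<le> a i" "\<And>i. i \<in> I \<Longrightarrow> G i t = F (a i * t)"
      "\<And>i s. i \<in> I \<Longrightarrow> 0 < s \<Longrightarrow> s \<le> t \<Longrightarrow> F (a i * s) \<le> G i s"
    by (metis (no_types, lifting))
  define p where "p = (\<Sum>i\<in>I. w i * F (a i * t))"
  define A where "A = (\<Sum>i\<in>I. a i)"
  have const: "x = (\<Sum>i\<in>I. w i * x)" for x
    using I(3) by (simp add: sum_distrib_right[symmetric])
  have A: "0 \<le> A" "\<And>i. i \<in> I \<Longrightarrow> a i \<le> A"
    using a(1) I(1) by (auto simp: A_def intro: sum_nonneg member_le_sum)
  have "F 0 \<le> p"
    unfolding p_def by (subst const[of "F 0"]) (intro sum_mono mult_left_mono mono I a(1), use a t in auto)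
  moreover have "p \<le> F (A * t)"
    unfolding p_def
    by (subst const[of "F (A * t)"])
      (intro sum_mono mult_left_mono mono I, use a A t in \<open>auto intro: mult_right_mono\<close>)
  ultimately obtain c where c: "0 \<le> c" "F (c * t) = p"
    using rescaling_value[OF deriv A(1), of p t] by blast
  have "F (c * s) \<le> (\<Sum>i\<in>I. w i * G i s)" if s: "0 < s" "s \<le> t" for s
  proof (cases "c = 0")
    case True
    have "F 0 \<le> G i s" if "i \<in> I" for i
      using mono[of 0 "a i * s"] a(1)[OF that] a(3)[OF that s] s by simp
    then have "(\<Sum>i\<in>I. w i * F 0) \<le> (\<Sum>i\<in>I. w i * G i s)"
      by (intro sum_mono mult_left_mono I)
    then show ?thesis using True const[of "F 0"] by simp
  next
    case False
    define \<kappa> where "\<kappa> = (s * f (c * s)) / (t * f (c * t))"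
    have "0 = (\<Sum>i\<in>I. w i * (\<kappa> * (F (a i * t) - F (c * t))))"
      using c(2) I(3) unfolding p_def
      by (simp add: algebra_simps sum_subtractf sum_distrib_left[symmetric] sum_distrib_right[symmetric])
    also have "\<dots> \<le> (\<Sum>i\<in>I. w i * (F (a i * s) - F (c * s)))"
      unfolding \<kappa>_def
      by (intro sum_mono mult_left_mono scaled_supporting_line deriv pos sub I a) (use False c s in auto)
    also have "\<dots> \<le> (\<Sum>i\<in>I. w i * (G i s - F (c * s)))"
      by (intro sum_mono mult_left_mono I diff_right_mono a s)
    also have "\<dots> = (\<Sum>i\<in>I. w i * G i s) - F (c * s)"
      by (simp add: right_diff_distrib sum_subtractf const[symmetric])
    finally show ?thesis by simp
  qed
  then show "\<exists>c\<ge>0. (\<Sum>i\<in>I. w i * G i t) = F (c * t) \<and>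
      (\<forall>s. 0 < s \<and> s \<le> t \<longrightarrow> F (c * s) \<le> (\<Sum>i\<in>I. w i * G i s))"
    using c a(2) by (intro exI[of _ c]) (simp add: p_def)
qed

section \<open>Order statistics in the star order\<close>

text \<open>The increment of the first distribution function between \<open>a * x\<close> and \<open>c * x\<close>, relative to the density of the
  next one at \<open>c * x\<close>, increases in \<open>x\<close>: it is the integral over \<open>b\<close> from \<open>a\<close> to \<open>c\<close> of the quotient in
  \<open>iid_density_Suc_sub_multiplicative\<close> with \<open>b\<close> in place of \<open>a\<close>.\<close>

lemma iid_cdf_increment_ratio_mono:
  assumes kn: "k \<le> n" and ac: "0 \<le> a" "a \<le> c" and st: "0 < s" "s \<le> t"
  shows "(iid_cdf (Suc n) (Suc k) (c * s) - iid_cdf (Suc n) (Suc k) (a * s))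
      * iid_density (Suc n) (Suc k) (c * t)
    \<le> (iid_cdf (Suc n) (Suc k) (c * t) - iid_cdf (Suc n) (Suc k) (a * t))
      * iid_density (Suc n) (Suc k) (c * s)"
proof -
  let ?F = "iid_cdf (Suc n) (Suc k)" and ?f = "iid_density n k" and ?g = "iid_density (Suc n) (Suc k)"
  let ?\<psi> = "\<lambda>x. ?F (x * t) * ?g (c * s) - ?F (x * s) * ?g (c * t)"
  have der: "(?\<psi> has_real_derivative t * ?f (x * t) * ?g (c * s) - s * ?f (x * s) * ?g (c * t)) (at x)" for x
  proof -
    have "((\<lambda>x. ?F (x * u)) has_real_derivative ?f (x * u) * u) (at x)" for u
      by (rule DERIV_chain2[OF DERIV_iid_cdf]) (auto intro!: derivative_eq_intros)
    from DERIV_diff[OF DERIV_cmult_right[OF this[of t], of "?g (c * s)"]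
        DERIV_cmult_right[OF this[of s], of "?g (c * t)"]]
    show ?thesis by (simp add: mult_ac)
  qed
  have "?\<psi> a \<le> ?\<psi> c"
  proof (rule DERIV_nonneg_imp_increasing_open[OF ac(2)])
    fix x assume x: "a < x" "x < c"
    then have "s * ?f (x * s) * ?g (c * t) \<le> t * ?f (x * t) * ?g (c * s)"
      using ac st by (intro iid_density_Suc_sub_multiplicative) auto
    then show "\<exists>y. (?\<psi> has_real_derivative y) (at x) \<and> 0 \<le> y" using der[of x] by force
  qed (intro continuous_at_imp_continuous_on ballI DERIV_isCont[OF der])
  then show ?thesis by (simp add: algebra_simps)
qed

lemma iid_cdf_zero: "iid_cdf n (Suc k) 0 = 0"
  by (simp add: iid_cdf_def order_cdf_zero)

lemma order_cdf_1:
  "finite S \<Longrightarrow> order_cdf r (Suc 0) S x = 1 - exp (- ((\<Sum>i\<in>S. r i) * x))"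
proof (induction S rule: finite_induct)
  case empty
  then show ?case by (simp add: order_cdf_def at_least_empty)
next
  case (insert j S)
  have "order_cdf r 0 S x = 1" using insert.hyps by (simp add: order_cdf_def at_least_0)
  moreover have "exp (- ((\<Sum>i\<in>insert j S. r i) * x)) = exp (- (r j * x)) * exp (- ((\<Sum>i\<in>S. r i) * x))"
    using insert.hyps by (simp add: exp_add[symmetric] algebra_simps)
  ultimately show ?case
    using insert.hyps insert.IH by (simp add: order_cdf_insert right_diff_distrib)
qed

lemma order_cdf_nonneg:
  assumes "\<And>i. i \<in> S \<Longrightarrow> 0 < r i" "0 \<le> x"
  shows "0 \<le> order_cdf r k S x"
  unfolding order_cdf_def by (rule at_least_nonneg) (use assms in \<open>auto simp: less_imp_le\<close>)

text \<open>The induction step: star order for the samples with one item removed gives star order for the whole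
  sample, through the differential equation for \<open>order_cdf\<close>.\<close>

lemma star_below_order_cdf_step:
  assumes S: "finite S" "card S = Suc (Suc n)" and r: "\<And>i. i \<in> S \<Longrightarrow> 0 < r i" and kn: "k \<le> n"
    and IH: "\<And>i. i \<in> S \<Longrightarrow> star_below (iid_cdf (Suc n) (Suc k)) (order_cdf r (Suc k) (S - {i}))"
  shows "star_below (iid_cdf (Suc (Suc n)) (Suc (Suc k))) (order_cdf r (Suc (Suc k)) S)"
  unfolding star_below_def
proof (intro allI impI)
  fix t :: real assume t: "0 < t"
  define F where "F = iid_cdf (Suc (Suc n)) (Suc (Suc k))"
  define f where "f = iid_density (Suc n) (Suc k)"
  define F' where "F' = iid_cdf (Suc n) (Suc k)"
  define N where "N = real (Suc (Suc n))"
  define \<Lambda> where "\<Lambda> = (\<Sum>i\<in>S. r i)"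
  define G where "G = order_cdf r (Suc (Suc k)) S"
  define H where "H x = (\<Sum>i\<in>S. r i / \<Lambda> * order_cdf r (Suc k) (S - {i}) x)" for x
  have Sne: "S \<noteq> {}" using S by auto
  have \<Lambda>: "0 < \<Lambda>" unfolding \<Lambda>_def using S(1) Sne r by (rule sum_pos)
  have N: "0 < N" by (simp add: N_def)
  have F_f: "F y = F' y - f y / N" for y
    by (simp add: F_def F'_def f_def N_def iid_density_eq del: of_nat_Suc)
  have dF: "(F has_real_derivative f y) (at y)" for y unfolding F_def f_def by (rule DERIV_iid_cdf)
  have f_pos: "0 < f y" if "0 < y" for y using that kn by (simp add: f_def iid_density_pos)
  have F'_mono: "F' a \<le> F' b" if "0 \<le> a" "a \<le> b" for a b
    unfolding F'_def using DERIV_iid_cdf iid_density_pos[OF kn] that by (rule pos_density_mono)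
  have zero: "F 0 = 0" "G 0 = 0" using S(1)
    by (simp_all add: F_def G_def iid_cdf_zero order_cdf_zero)
  have H: "star_below F' H"
    unfolding F'_def H_def
    by (rule star_below_mixture[OF DERIV_iid_cdf iid_density_pos[OF kn] iid_density_sub_multiplicative])
      (use S(1) r \<Lambda> IH in \<open>auto simp: less_imp_le sum_divide_distrib[symmetric] \<Lambda>_def[symmetric]\<close>)
  have dG: "(G has_real_derivative \<Lambda> * (H x - G x)) (at x)" for x
  proof -
    have "\<Lambda> * (H x - G x) = (\<Sum>i\<in>S. r i * (order_cdf r (Suc k) (S - {i}) x - G x))"
      using \<Lambda> by (simp add: H_def right_diff_distrib sum_subtractf sum_distrib_left
          sum_distrib_right[symmetric] \<Lambda>_def[symmetric])
    then show ?thesis using DERIV_order_cdf[OF S(1), of r "Suc (Suc k)" x] by (simp add: G_def)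
  qed
  have "G t \<le> F (\<Lambda> / N * t)"
    using order_cdf_le_mean[OF S(1) Sne, of r t "Suc (Suc k)"] r t S(2)
    by (simp add: G_def F_def \<Lambda>_def N_def)
  moreover have "F 0 \<le> G t" using order_cdf_nonneg[of S r t] r t zero by (simp add: G_def)
  ultimately obtain c where c: "0 \<le> c" "c \<le> \<Lambda> / N" "F (c * t) = G t"
    using rescaling_value[OF dF, of "\<Lambda> / N" "G t" t] \<Lambda> N by auto
  have "F (c * s) \<le> G s" if s: "0 < s" "s \<le> t" for s
  proof (cases "c = 0 \<or> s = t")
    case True
    then show ?thesis using c zero order_cdf_nonneg[of S r s] r s by (auto simp: G_def)
  next
    case False
    then have cpos: "0 < c" and st: "s < t" using c s by auto
    define b where "b x = \<Lambda> * (H x - F' (c * x)) + (\<Lambda> - N * c) * f (c * x) / N" for x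
    define E where "E x = exp (\<Lambda> * x) * (G x - F (c * x))" for x
    have dE: "(E has_real_derivative exp (\<Lambda> * x) * b x) (at x)" for x
    proof -
      have 1: "((\<lambda>x. F (c * x)) has_real_derivative f (c * x) * c) (at x)"
        by (rule DERIV_chain2[OF dF]) (auto intro!: derivative_eq_intros)
      have 2: "((\<lambda>x. exp (\<Lambda> * x)) has_real_derivative exp (\<Lambda> * x) * \<Lambda>) (at x)"
        by (auto intro!: derivative_eq_intros)
      have "exp (\<Lambda> * x) * \<Lambda> * (G x - F (c * x)) + (\<Lambda> * (H x - G x) - f (c * x) * c) * exp (\<Lambda> * x)
          = exp (\<Lambda> * x) * b x"
        using N by (simp add: b_def F_f field_simps)
      then show ?thesis
        using DERIV_mult[OF 2 DERIV_diff[OF dG 1]] unfolding E_def by simp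
    qed
    \<comment> \<open>Let \<open>a\<close> be the rate matching \<open>H\<close> at \<open>y\<close>. If \<open>c \<le> a\<close>, then \<open>H x \<ge> F' (c * x)\<close> and both summands of
      \<open>b x\<close> are nonnegative; otherwise \<open>b x / f (c * x)\<close> is at least \<open>b y / f (c * y)\<close>.\<close>
    have sign: "0 \<le> b x" if xy: "0 < x" "x < y" and nn: "0 \<le> b y" for x y
    proof -
      have fpos: "0 < f (c * x)" "0 < f (c * y)" using cpos xy by (auto intro: f_pos)
      have slack: "0 \<le> (\<Lambda> - N * c) / N" using c(2) N by (simp add: field_simps)
      obtain a where a: "0 \<le> a" "H y = F' (a * y)" "F' (a * x) \<le> H x"
        using star_belowE[OF H, of y] xy by (metis less_imp_le less_trans)
      show ?thesis
      proof (cases "c \<le> a")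
        case True
        then have "F' (c * x) \<le> F' (a * x)" using c xy by (intro F'_mono) auto
        then have "0 \<le> \<Lambda> * (H x - F' (c * x))" using a \<Lambda> by simp
        moreover have "0 \<le> (\<Lambda> - N * c) * f (c * x) / N"
          using mult_nonneg_nonneg[OF slack less_imp_le[OF fpos(1)]] by simp
        ultimately show ?thesis by (simp add: b_def)
      next
        case False
        have "0 \<le> b y * f (c * x)" using nn fpos by simp
        also have "\<dots> = (\<Lambda> - N * c) / N * f (c * x) * f (c * y)
            - \<Lambda> * ((F' (c * y) - F' (a * y)) * f (c * x))"
          using N by (simp add: b_def a field_simps)
        also have "\<dots> \<le> (\<Lambda> - N * c) / N * f (c * x) * f (c * y)
            - \<Lambda> * ((F' (c * x) - F' (a * x)) * f (c * y))"
          using iid_cdf_increment_ratio_mono[OF kn a(1), of c x y] False xy \<Lambda>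
          by (simp add: F'_def f_def)
        also have "\<dots> = ((\<Lambda> - N * c) / N * f (c * x) - \<Lambda> * (F' (c * x) - F' (a * x))) * f (c * y)"
          by (simp add: algebra_simps)
        also have "\<dots> \<le> b x * f (c * y)"
        proof (rule mult_right_mono)
          have "\<Lambda> * F' (a * x) \<le> \<Lambda> * H x" using a \<Lambda> by simp
          then show "(\<Lambda> - N * c) / N * f (c * x) - \<Lambda> * (F' (c * x) - F' (a * x)) \<le> b x"
            by (simp add: b_def algebra_simps)
        qed (use fpos in simp)
        finally show ?thesis using fpos by (simp add: zero_le_mult_iff)
      qed
    qed
    show ?thesis
    proof (rule ccontr)
      assume "\<not> ?thesis"
      then have Es: "E s < 0" by (simp add: E_def mult_pos_neg)
      have E0: "E 0 = 0" "E t = 0" using zero c by (simp_all add: E_def)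
      \<comment> \<open>\<open>E\<close> falls from \<open>0\<close> to \<open>E s < 0\<close> and rises back to \<open>0\<close>, so \<open>b\<close> changes sign the wrong way.\<close>
      obtain x where x: "0 < x" "x < s" "E s - E 0 = (s - 0) * (exp (\<Lambda> * x) * b x)"
        using MVT2[OF s(1), of E "\<lambda>x. exp (\<Lambda> * x) * b x"] dE by blast
      obtain y where y: "s < y" "y < t" "E t - E s = (t - s) * (exp (\<Lambda> * y) * b y)"
        using MVT2[OF st, of E "\<lambda>x. exp (\<Lambda> * x) * b x"] dE by blast
      have "b x < 0"
        using x E0 Es s by (simp add: mult_less_0_iff)
      moreover have "0 < (t - s) * (exp (\<Lambda> * y) * b y)" using y E0 Es by simp
      then have "0 \<le> b y" using st by (simp add: zero_less_mult_iff)
      ultimately show False using sign[of x y] x y by simp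
    qed
  qed
  then show "\<exists>a\<ge>0. order_cdf r (Suc (Suc k)) S t = iid_cdf (Suc (Suc n)) (Suc (Suc k)) (a * t) \<and>
      (\<forall>s. 0 < s \<and> s \<le> t \<longrightarrow> iid_cdf (Suc (Suc n)) (Suc (Suc k)) (a * s) \<le> order_cdf r (Suc (Suc k)) S s)"
    using c by (auto simp: F_def G_def intro!: exI[of _ c])
qed

text \<open>For the minimum both distributions are exponential, so the matched rate is constantly the average rate and
  the induction can start.\<close>

theorem star_below_order_cdf:
  assumes "finite S" "\<And>i. i \<in> S \<Longrightarrow> 0 < r i" "Suc k \<le> card S"
  shows "star_below (iid_cdf (card S) (Suc k)) (order_cdf r (Suc k) S)"
  using assms
proof (induction k arbitrary: S)
  case 0
  have n: "0 < card S" using 0 by simp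
  have F: "iid_cdf (card S) (Suc 0) y = 1 - exp (- (real (card S) * y))" for y
    by (simp add: iid_cdf_def order_cdf_1)
  have "0 \<le> (\<Sum>i\<in>S. r i) / real (card S)"
    using 0 by (intro divide_nonneg_nonneg sum_nonneg) (auto simp: less_imp_le)
  then show ?case
    unfolding star_below_def F order_cdf_1[OF 0(1)]
    using n by (auto intro!: exI[of _ "(\<Sum>i\<in>S. r i) / real (card S)"])
next
  case (Suc k)
  obtain n where n: "card S = Suc (Suc n)" "k \<le> n"
    using Suc.prems(3) by (metis Suc_le_D Suc_le_mono)
  have "star_below (iid_cdf (Suc n) (Suc k)) (order_cdf r (Suc k) (S - {i}))" if "i \<in> S" for i
    using Suc.IH[of "S - {i}"] Suc.prems n that by (auto simp: card_Diff_singleton)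
  then show ?case
    using star_below_order_cdf_step[of S n r k] Suc.prems n by auto
qed

section \<open>Order statistics as counts\<close>

text \<open>The members of a sorted list with a downward closed property form an initial segment.\<close>

lemma sorted_nth_downclosed_iff:
  assumes "sorted ys" "i < length ys" and down: "\<And>x y. P y \<Longrightarrow> x \<le> y \<Longrightarrow> P x"
  shows "P (ys ! i) \<longleftrightarrow> i < length (filter P ys)"
  using assms(1,2)
proof (induction ys arbitrary: i)
  case (Cons y ys)
  show ?case
  proof (cases "P y")
    case True
    then show ?thesis using Cons by (cases i) auto
  next
    case False
    have "\<not> P z" if "z \<in> set (y # ys)" for z
      using that False Cons.prems(1) down by auto
    then have "filter P (y # ys) = []" "\<not> P ((y # ys) ! i)"
      using Cons.prems(2) nth_mem by (blast intro: filter_False)+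
    then show ?thesis by simp
  qed
qed simp

text \<open>The general form covers both \<open>order_stat \<le> t\<close>, which describes distribution functions, and
  \<open>order_stat < t\<close>, which locates the item attaining the order statistic.\<close>

lemma order_stat_downclosed_iff:
  assumes j: "1 \<le> j" "j \<le> n" and down: "\<And>x y::real. P y \<Longrightarrow> x \<le> y \<Longrightarrow> P x"
  shows "P (order_stat n X j \<omega>) \<longleftrightarrow> j \<le> card {i \<in> {1..n}. P (X i \<omega>)}"
proof -
  let ?xs = "map (\<lambda>i. X i \<omega>) [1..<Suc n]"
  have "length (filter P (sort ?xs)) = length (filter P ?xs)"
    by (metis mset_filter mset_sort size_mset)
  also have "\<dots> = card (set (filter (\<lambda>i. P (X i \<omega>)) [1..<Suc n]))"
    unfolding filter_map length_map comp_def by (rule distinct_card[symmetric]) simp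
  also have "set (filter (\<lambda>i. P (X i \<omega>)) [1..<Suc n]) = {i \<in> {1..n}. P (X i \<omega>)}"
    by (auto simp del: upt_Suc)
  finally have len: "length (filter P (sort ?xs)) = card {i \<in> {1..n}. P (X i \<omega>)}" .
  have "P (sort ?xs ! (j - 1)) \<longleftrightarrow> j - 1 < length (filter P (sort ?xs))"
    by (rule sorted_nth_downclosed_iff) (use j down in auto)
  then show ?thesis unfolding order_stat_def len using j by auto
qed

lemma order_stat_le_iff:
  assumes "1 \<le> j" "j \<le> n"
  shows "order_stat n X j \<omega> \<le> t \<longleftrightarrow> j \<le> card {i \<in> {1..n}. X i \<omega> \<le> t}"
  using assms by (rule order_stat_downclosed_iff) simp

lemma order_stat_mem:
  assumes "1 \<le> j" "j \<le> n"
  obtains i where "i \<in> {1..n}" "order_stat n X j \<omega> = X i \<omega>"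
proof -
  let ?xs = "map (\<lambda>i. X i \<omega>) [1..<Suc n]"
  have "sort ?xs ! (j - 1) \<in> set (sort ?xs)" using assms by (intro nth_mem) auto
  then obtain i where "i \<in> set [1..<Suc n]" "sort ?xs ! (j - 1) = X i \<omega>" by (auto simp del: upt_Suc)
  then show thesis using that[of i] unfolding order_stat_def by (auto simp del: upt_Suc)
qed

text \<open>The possible states at the \<open>m\<close>th failure: the item \<open>i\<close> failing then and the set \<open>B\<close> of survivors.\<close>

definition blocks :: "nat \<Rightarrow> nat \<Rightarrow> (nat \<times> nat set) set" where
  "blocks n m = (SIGMA i:{1..n}. {B. B \<subseteq> {1..n} - {i} \<and> card B = n - m})"

definition block_event :: "nat \<Rightarrow> (nat \<Rightarrow> 'a \<Rightarrow> real) \<Rightarrow> nat \<times> nat set \<Rightarrow> 'a \<Rightarrow> bool" where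
  "block_event n X = (\<lambda>(i, B) \<omega>.
     (\<forall>a\<in>{1..n} - {i} - B. X a \<omega> \<le> X i \<omega>) \<and> (\<forall>j\<in>B. X i \<omega> < X j \<omega>))"

lemma finite_blocks: "finite (blocks n m)"
  unfolding blocks_def by (intro finite_SigmaI) auto

context
  fixes n m :: nat and X :: "nat \<Rightarrow> 'a \<Rightarrow> real" and \<omega> :: 'a and i :: nat and B :: "nat set"
  assumes m: "1 \<le> m" "m \<le> n" and iB: "(i, B) \<in> blocks n m" and ev: "block_event n X (i, B) \<omega>"
begin

lemma
  shows block_index: "i \<in> {1..n}" and block_subset: "B \<subseteq> {1..n} - {i}" and block_card: "card B = n - m"
    and block_above: "B = {j \<in> {1..n}. X i \<omega> < X j \<omega>}"
proof -
  show "i \<in> {1..n}" and B: "B \<subseteq> {1..n} - {i}" and "card B = n - m"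
    using iB by (auto simp: blocks_def)
  have "\<not> X i \<omega> < X j \<omega>" if "j \<in> {1..n}" "j \<notin> B" for j
    using ev that by (cases "j = i") (auto simp: block_event_def not_less)
  moreover have "X i \<omega> < X j \<omega>" if "j \<in> B" for j
    using ev that by (auto simp: block_event_def)
  ultimately show "B = {j \<in> {1..n}. X i \<omega> < X j \<omega>}"
    using B by blast
qed

lemma block_complement_card: "card ({1..n} - B) = m"
  using block_subset block_card m by (subst card_Diff_subset) (auto intro: finite_subset)

lemma order_stat_block: "order_stat n X m \<omega> = X i \<omega>"
proof (rule antisym)
  have "{j \<in> {1..n}. X j \<omega> \<le> X i \<omega>} = {1..n} - B"
    using block_above by auto
  then show "order_stat n X m \<omega> \<le> X i \<omega>"
    using m block_complement_card by (simp add: order_stat_le_iff)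
next
  show "X i \<omega> \<le> order_stat n X m \<omega>"
  proof (rule ccontr)
    assume less: "\<not> ?thesis"
    have "m \<le> card {j \<in> {1..n}. X j \<omega> \<le> order_stat n X m \<omega>}"
      using m order_stat_le_iff[of m n X \<omega> "order_stat n X m \<omega>"] by blast
    also have "\<dots> \<le> card ({1..n} - B - {i})"
    proof (rule card_mono)
      have "j \<notin> B \<and> j \<noteq> i" if "X j \<omega> \<le> order_stat n X m \<omega>" for j
        using that less block_above by fastforce
      then show "{j \<in> {1..n}. X j \<omega> \<le> order_stat n X m \<omega>} \<subseteq> {1..n} - B - {i}" by blast
    qed simp
    also have "\<dots> < m"
    proof -
      have "i \<in> {1..n} - B" using block_index block_subset by blast
      then show ?thesis
        using block_complement_card m by (simp add: card_Diff_singleton del: One_nat_def)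
    qed
    finally show False by simp
  qed
qed

lemma spacing_block_le_iff:
  assumes k: "m < k" "k \<le> n" and t: "0 \<le> t"
  shows "order_stat n X k \<omega> - order_stat n X m \<omega> \<le> t \<longleftrightarrow> k - m \<le> card {j \<in> B. X j \<omega> \<le> X i \<omega> + t}"
proof -
  have "{j \<in> {1..n}. X j \<omega> \<le> X i \<omega> + t} = ({1..n} - B) \<union> {j \<in> B. X j \<omega> \<le> X i \<omega> + t}"
  proof (intro set_eqI iffI)
    fix j assume "j \<in> {j \<in> {1..n}. X j \<omega> \<le> X i \<omega> + t}"
    then show "j \<in> ({1..n} - B) \<union> {j \<in> B. X j \<omega> \<le> X i \<omega> + t}" by blast
  next
    fix j assume j: "j \<in> ({1..n} - B) \<union> {j \<in> B. X j \<omega> \<le> X i \<omega> + t}"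
    show "j \<in> {j \<in> {1..n}. X j \<omega> \<le> X i \<omega> + t}"
    proof (cases "j \<in> B")
      case True
      then show ?thesis using j block_subset by blast
    next
      case False
      then have "j \<in> {1..n}" "\<not> X i \<omega> < X j \<omega>" using j block_above by blast+
      then show ?thesis using t by simp
    qed
  qed
  moreover have "card (({1..n} - B) \<union> {j \<in> B. X j \<omega> \<le> X i \<omega> + t})
      = card ({1..n} - B) + card {j \<in> B. X j \<omega> \<le> X i \<omega> + t}"
    by (rule card_Un_disjoint) (use finite_subset[OF block_subset finite_Diff[OF finite_atLeastAtMost]] in auto)
  ultimately have "card {j \<in> {1..n}. X j \<omega> \<le> X i \<omega> + t} = m + card {j \<in> B. X j \<omega> \<le> X i \<omega> + t}"
    using block_complement_card by simp
  moreover have "order_stat n X k \<omega> - order_stat n X m \<omega> \<le> t \<longleftrightarrow> order_stat n X k \<omega> \<le> X i \<omega> + t"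
    by (simp add: order_stat_block algebra_simps)
  moreover have "order_stat n X k \<omega> \<le> X i \<omega> + t \<longleftrightarrow> k \<le> card {j \<in> {1..n}. X j \<omega> \<le> X i \<omega> + t}"
    using k by (intro order_stat_le_iff) auto
  ultimately show ?thesis using k by linarith
qed

end

text \<open>Without ties, exactly one state at the \<open>m\<close>th failure occurs; the events \<open>block_event\<close> thus partition the
  sample space up to a null set.\<close>

lemma ex1_block:
  assumes m: "1 \<le> m" "m \<le> n" and inj: "inj_on (\<lambda>i. X i \<omega>) {1..n}"
  shows "\<exists>!b. b \<in> blocks n m \<and> block_event n X b \<omega>"
proof (rule ex_ex1I)
  obtain i where i: "i \<in> {1..n}" "order_stat n X m \<omega> = X i \<omega>" using order_stat_mem[OF m] .
  define B where "B = {j \<in> {1..n}. X i \<omega> < X j \<omega>}"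
  have le: "m \<le> card {j \<in> {1..n}. X j \<omega> \<le> X i \<omega>}"
    using m order_stat_le_iff[of m n X \<omega> "X i \<omega>"] i by simp
  \<comment> \<open>Fewer than \<open>m\<close> values lie strictly below \<open>X i\<close>, and without ties only \<open>i\<close> is added at \<open>X i\<close>.\<close>
  have lt: "\<not> m \<le> card {j \<in> {1..n}. X j \<omega> < X i \<omega>}"
    using m order_stat_downclosed_iff[of m n "\<lambda>x. x < X i \<omega>" X \<omega>] i by auto
  have "{j \<in> {1..n}. X j \<omega> \<le> X i \<omega>} = insert i {j \<in> {1..n}. X j \<omega> < X i \<omega>}"
  proof (intro set_eqI iffI)
    fix j assume "j \<in> {j \<in> {1..n}. X j \<omega> \<le> X i \<omega>}"
    then show "j \<in> insert i {j \<in> {1..n}. X j \<omega> < X i \<omega>}"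
      using inj_onD[OF inj _ _ i(1), of j] by (cases "X j \<omega> = X i \<omega>") auto
  qed (use i(1) in auto)
  then have "card {j \<in> {1..n}. X j \<omega> \<le> X i \<omega>} = m"
    using le lt by simp
  moreover have "card ({1..n} - {j \<in> {1..n}. X j \<omega> \<le> X i \<omega>})
      = card {1..n} - card {j \<in> {1..n}. X j \<omega> \<le> X i \<omega>}"
    by (rule card_Diff_subset) auto
  moreover have "B = {1..n} - {j \<in> {1..n}. X j \<omega> \<le> X i \<omega>}" by (auto simp: B_def)
  ultimately have "card B = n - m" by (simp only: card_atLeastAtMost diff_Suc_1)
  then have "(i, B) \<in> blocks n m" "block_event n X (i, B) \<omega>"
    using i by (auto simp: blocks_def block_event_def B_def not_less)
  then show "\<exists>b. b \<in> blocks n m \<and> block_event n X b \<omega>" by blast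
next
  fix b c
  assume b: "b \<in> blocks n m \<and> block_event n X b \<omega>" and c: "c \<in> blocks n m \<and> block_event n X c \<omega>"
  obtain i B j C where bc: "b = (i, B)" "c = (j, C)" by fastforce
  have b: "(i, B) \<in> blocks n m" "block_event n X (i, B) \<omega>"
    and c: "(j, C) \<in> blocks n m" "block_event n X (j, C) \<omega>" using b c bc by auto
  have "X i \<omega> = X j \<omega>"
    using order_stat_block[OF m b] order_stat_block[OF m c] by simp
  then have "i = j"
    using inj_onD[OF inj _ block_index[OF m b] block_index[OF m c]] by simp
  moreover note block_above[OF m b] block_above[OF m c]
  ultimately show "b = c" using bc by simp
qed

text \<open>Turns a statement about a cardinality into finite quantifiers, for measurability.\<close>

lemma le_card_filter_iff:
  assumes "finite B"
  shows "k \<le> card {j \<in> B. P j} \<longleftrightarrow> (\<exists>T\<in>{T \<in> Pow B. k \<le> card T}. \<forall>j\<in>T. P j)"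
proof
  assume "k \<le> card {j \<in> B. P j}"
  then show "\<exists>T\<in>{T \<in> Pow B. k \<le> card T}. \<forall>j\<in>T. P j"
    by (intro bexI[of _ "{j \<in> B. P j}"]) auto
next
  assume "\<exists>T\<in>{T \<in> Pow B. k \<le> card T}. \<forall>j\<in>T. P j"
  then obtain T where T: "T \<subseteq> {j \<in> B. P j}" "k \<le> card T" by blast
  then show "k \<le> card {j \<in> B. P j}"
    using card_mono[OF _ T(1)] assms by auto
qed

lemma pred_le_card:
  assumes "finite B" "\<And>j. j \<in> B \<Longrightarrow> Measurable.pred M (P j)"
  shows "Measurable.pred M (\<lambda>x. k \<le> card {j \<in> B. P j x})"
  unfolding le_card_filter_iff[OF assms(1)]
proof (intro pred_intros_finite)
  show "finite {T \<in> Pow B. k \<le> card T}" using assms(1) by simp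
  show "finite T" if "T \<in> {T \<in> Pow B. k \<le> card T}" for T
    using that assms(1) finite_subset by blast
  show "Measurable.pred M (P j)" if "T \<in> {T \<in> Pow B. k \<le> card T}" "j \<in> T" for T j
    using that by (intro assms(2)) blast
qed

lemma measurable_order_stat:
  assumes "1 \<le> j" "j \<le> n" "\<And>i. i \<in> {1..n} \<Longrightarrow> X i \<in> borel_measurable M"
  shows "order_stat n X j \<in> borel_measurable M"
proof (rule borel_measurableI_le)
  fix t
  have "Measurable.pred M (\<lambda>\<omega>. j \<le> card {i \<in> {1..n}. X i \<omega> \<le> t})"
  proof (rule pred_le_card)
    show "Measurable.pred M (\<lambda>\<omega>. X i \<omega> \<le> t)" if "i \<in> {1..n}" for i
      using assms(3)[OF that] unfolding pred_def borel_measurable_iff_le by blast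
  qed simp
  then show "{\<omega> \<in> space M. order_stat n X j \<omega> \<le> t} \<in> sets M"
    unfolding pred_def order_stat_le_iff[OF assms(1,2)] .
qed

section \<open>Lack of memory at the time of a failure\<close>

context prob_space
begin

text \<open>Fubini for independent variables: \<open>U\<close> may be frozen at \<open>U \<omega>'\<close> while \<open>V\<close> varies, and then averaged. Integrating
  over \<open>M\<close> itself instead of the law of \<open>U\<close> keeps almost sure properties of \<open>U\<close> usable as they stand.\<close>

lemma
  assumes ind: "indep_var S U T V" and W: "W \<in> sets (S \<Otimes>\<^sub>M T)"
  shows emeasure_indep_var_pair: "emeasure M {\<omega> \<in> space M. (U \<omega>, V \<omega>) \<in> W}
      = (\<integral>\<^sup>+ \<omega>'. emeasure M {\<omega> \<in> space M. (U \<omega>', V \<omega>) \<in> W} \<partial>M)"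
    and measurable_emeasure_section:
      "(\<lambda>\<omega>'. emeasure M {\<omega> \<in> space M. (U \<omega>', V \<omega>) \<in> W}) \<in> borel_measurable M"
proof -
  have U: "U \<in> measurable M S" and V: "V \<in> measurable M T"
    and eq: "distr M S U \<Otimes>\<^sub>M distr M T V = distr M (S \<Otimes>\<^sub>M T) (\<lambda>x. (U x, V x))"
    using ind unfolding indep_var_distribution_eq by auto
  interpret V: prob_space "distr M T V" by (rule prob_space_distr) fact
  have UV: "(\<lambda>x. (U x, V x)) \<in> measurable M (S \<Otimes>\<^sub>M T)" using U V by (rule measurable_Pair)
  have sect: "emeasure (distr M T V) (Pair s -` W) = emeasure M {\<omega> \<in> space M. (s, V \<omega>) \<in> W}" for s
    using emeasure_distr[OF V sets_Pair1[OF W]] by (simp add: vimage_def Int_def conj_commute)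
  have meas: "(\<lambda>s. emeasure (distr M T V) (Pair s -` W)) \<in> borel_measurable S"
    using V.measurable_emeasure_Pair[of W S] W by (simp cong: sets_pair_measure_cong)
  show "(\<lambda>\<omega>'. emeasure M {\<omega> \<in> space M. (U \<omega>', V \<omega>) \<in> W}) \<in> borel_measurable M"
    using measurable_compose[OF U meas] unfolding sect .
  have "emeasure M {\<omega> \<in> space M. (U \<omega>, V \<omega>) \<in> W} = emeasure (distr M (S \<Otimes>\<^sub>M T) (\<lambda>x. (U x, V x))) W"
    using emeasure_distr[OF UV W] by (simp add: vimage_def Int_def conj_commute)
  also have "\<dots> = emeasure (distr M S U \<Otimes>\<^sub>M distr M T V) W" by (simp add: eq)
  also have "\<dots> = (\<integral>\<^sup>+ s. emeasure (distr M T V) (Pair s -` W) \<partial>distr M S U)"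
    by (rule V.emeasure_pair_measure_alt) (use W in \<open>simp cong: sets_pair_measure_cong\<close>)
  also have "\<dots> = (\<integral>\<^sup>+ \<omega>'. emeasure (distr M T V) (Pair (U \<omega>') -` W) \<partial>M)"
    by (rule nn_integral_distr[OF U]) (use meas in simp)
  finally show "emeasure M {\<omega> \<in> space M. (U \<omega>, V \<omega>) \<in> W}
      = (\<integral>\<^sup>+ \<omega>'. emeasure M {\<omega> \<in> space M. (U \<omega>', V \<omega>) \<in> W} \<partial>M)"
    unfolding sect .
qed

lemma prob_all_indep_vars:
  assumes ind: "indep_vars (\<lambda>_. borel) X I" and "finite I" "\<And>i. i \<in> I \<Longrightarrow> Z i \<in> sets borel"
  shows "prob {\<omega> \<in> space M. \<forall>i\<in>I. X i \<omega> \<in> Z i} = (\<Prod>i\<in>I. prob {\<omega> \<in> space M. X i \<omega> \<in> Z i})"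
proof (cases "I = {}")
  case True
  then show ?thesis by (simp add: prob_space)
next
  case False
  have "{\<omega> \<in> space M. \<forall>i\<in>I. X i \<omega> \<in> Z i} = (\<Inter>i\<in>I. X i -` Z i \<inter> space M)"
    using False by auto
  moreover have "X i -` Z i \<inter> space M = {\<omega> \<in> space M. X i \<omega> \<in> Z i}" for i by auto
  ultimately show ?thesis
    using indep_varsD_finite[OF ind False assms(2), of Z] assms(3) by (simp only: if_False)
qed

end

locale independent_exponentials = prob_space +
  fixes I :: "nat set" and X :: "nat \<Rightarrow> 'a \<Rightarrow> real" and r :: "nat \<Rightarrow> real"
  assumes finite_I: "finite I" and rate_pos: "\<And>i. i \<in> I \<Longrightarrow> 0 < r i"
    and indep_X: "indep_vars (\<lambda>_. borel) X I"
    and exp_X: "\<And>i. i \<in> I \<Longrightarrow> distributed M lborel (X i) (exponential_density (r i))"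
begin

lemma X_measurable: "i \<in> I \<Longrightarrow> X i \<in> borel_measurable M"
  using indep_X by (auto simp: indep_vars_def)

lemma X_le_event: "i \<in> I \<Longrightarrow> {\<omega> \<in> space M. X i \<omega> \<le> t} \<in> events"
  using X_measurable borel_measurable_iff_le by blast

lemma prob_X_le: "i \<in> I \<Longrightarrow> 0 \<le> t \<Longrightarrow> prob {\<omega> \<in> space M. X i \<omega> \<le> t} = 1 - exp (- (r i * t))"
  using exponential_distributedD_le[OF exp_X _ rate_pos, of i t] by (simp add: mult.commute)

lemma prob_X_gt: "i \<in> I \<Longrightarrow> 0 \<le> t \<Longrightarrow> prob {\<omega> \<in> space M. t < X i \<omega>} = exp (- (r i * t))"
  using exponential_distributedD_gt[OF exp_X _ rate_pos, of i t] by (simp add: mult.commute)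

lemma prob_X_interval:
  assumes i: "i \<in> I" and st: "0 \<le> s" "0 \<le> t"
  shows "prob {\<omega> \<in> space M. X i \<omega> \<in> {s<..s + t}} = exp (- (r i * s)) * (1 - exp (- (r i * t)))"
proof -
  have "{\<omega> \<in> space M. X i \<omega> \<in> {s<..s + t}} =
      {\<omega> \<in> space M. X i \<omega> \<le> s + t} - {\<omega> \<in> space M. X i \<omega> \<le> s}"
    by auto
  moreover have sub: "{\<omega> \<in> space M. X i \<omega> \<le> s} \<subseteq> {\<omega> \<in> space M. X i \<omega> \<le> s + t}"
    using st by (auto intro: order_trans)
  ultimately have "prob {\<omega> \<in> space M. X i \<omega> \<in> {s<..s + t}} =
      prob {\<omega> \<in> space M. X i \<omega> \<le> s + t} - prob {\<omega> \<in> space M. X i \<omega> \<le> s}"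
    using finite_measure_Diff[OF X_le_event[OF i, of "s + t"] X_le_event[OF i, of s]] sub by (simp only:)
  also have "\<dots> = exp (- (r i * s)) - exp (- (r i * (s + t)))"
    using prob_X_le[OF i] st by simp
  also have "\<dots> = exp (- (r i * s)) * (1 - exp (- (r i * t)))"
    by (simp add: algebra_simps exp_add[symmetric])
  finally show ?thesis .
qed

lemma AE_X_pos: assumes "i \<in> I" shows "AE \<omega> in M. 0 < X i \<omega>"
proof -
  have "prob {\<omega> \<in> space M. X i \<omega> \<le> 0} = 0" using prob_X_le[OF assms, of 0] by simp
  then have "AE \<omega> in M. \<not> X i \<omega> \<le> 0"
    using X_le_event[OF assms] by (subst AE_iff_measurable[OF _ refl]) (auto simp: emeasure_eq_measure)
  then show ?thesis by (simp add: not_le)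
qed

lemma X_atomless: assumes "i \<in> I" shows "emeasure M {\<omega> \<in> space M. X i \<omega> = s} = 0"
proof -
  have "{\<omega> \<in> space M. X i \<omega> = s} = X i -` {s} \<inter> space M" by auto
  then show ?thesis
    using distributed_emeasure[OF exp_X[OF assms], of "{s}"] by (simp add: nn_integral_null_set)
qed

lemma AE_X_inj: "AE \<omega> in M. inj_on (\<lambda>i. X i \<omega>) I"
proof -
  have "AE \<omega> in M. X i \<omega> \<noteq> X j \<omega>" if ij: "i \<in> I" "j \<in> I" "i \<noteq> j" for i j
  proof -
    let ?P = "\<lambda>l. PiM {l} (\<lambda>_. borel :: real measure)"
    define W :: "((nat \<Rightarrow> real) \<times> (nat \<Rightarrow> real)) set"
      where "W = {p \<in> space (?P i \<Otimes>\<^sub>M ?P j). fst p i = snd p j}"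
    have [measurable]: "(\<lambda>f. f l) \<in> borel_measurable (?P l)" for l :: nat by simp
    have W: "W \<in> sets (?P i \<Otimes>\<^sub>M ?P j)" unfolding W_def by measurable
    have mem: "(restrict (\<lambda>l. X l \<omega>') {i}, restrict (\<lambda>l. X l \<omega>) {j}) \<in> W \<longleftrightarrow> X j \<omega> = X i \<omega>'" for \<omega> \<omega>'
      by (auto simp: W_def space_pair_measure space_PiM PiE_iff)
    have "indep_var (?P i) (\<lambda>\<omega>. restrict (\<lambda>l. X l \<omega>) {i}) (?P j) (\<lambda>\<omega>. restrict (\<lambda>l. X l \<omega>) {j})"
      by (rule indep_var_restrict[OF indep_X]) (use ij in auto)
    from emeasure_indep_var_pair[OF this W]
    have "emeasure M {\<omega> \<in> space M. X i \<omega> = X j \<omega>} = 0"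
      unfolding mem using X_atomless[OF ij(2)] by (simp add: eq_commute[of "X i _"])
    moreover have "{\<omega> \<in> space M. X i \<omega> = X j \<omega>} \<in> events"
      using X_measurable[of i] X_measurable[of j] ij by (intro borel_measurable_eq) auto
    ultimately show ?thesis by (subst AE_iff_measurable[OF _ refl]) auto
  qed
  then have "AE \<omega> in M. \<forall>i\<in>I. \<forall>j\<in>I. i \<noteq> j \<longrightarrow> X i \<omega> \<noteq> X j \<omega>"
    using finite_I by (simp add: AE_finite_all)
  then show ?thesis by eventually_elim (auto simp: inj_on_def)
qed

text \<open>Lack of memory at a fixed time \<open>s\<close>: given that exactly the items \<open>B\<close> of \<open>A \<union> B\<close> survive \<open>s\<close>, the number of
  failures among \<open>B\<close> by \<open>s + t\<close> is distributed as that of a fresh sample by time \<open>t\<close>. The event is split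
  according to the set \<open>T\<close> of items of \<open>B\<close> that fail by \<open>s + t\<close>.\<close>

lemma prob_split_at_level:
  assumes AB: "A \<union> B \<subseteq> I" "A \<inter> B = {}" and st: "0 \<le> s" "0 \<le> t"
  shows "prob {\<omega> \<in> space M. (\<forall>a\<in>A. X a \<omega> \<le> s) \<and> (\<forall>j\<in>B. s < X j \<omega>)
      \<and> k \<le> card {j \<in> B. X j \<omega> \<le> s + t}}
    = prob {\<omega> \<in> space M. (\<forall>a\<in>A. X a \<omega> \<le> s) \<and> (\<forall>j\<in>B. s < X j \<omega>)} * order_cdf r k B t"
proof -
  have fin: "finite A" "finite B" "finite (A \<union> B)" using AB finite_I finite_subset by blast+
  have ind: "indep_vars (\<lambda>_. borel) X (A \<union> B)" using indep_X AB(1) by (rule indep_vars_subset)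
  \<comment> \<open>\<open>D T\<close> is the event that within \<open>B\<close> exactly the items in \<open>T\<close> fail between \<open>s\<close> and \<open>s + t\<close>.\<close>
  define Z where "Z T i = (if i \<in> A then {..s} else if i \<in> T then {s<..s + t} else {s + t<..})" for T i
  define D where "D T = {\<omega> \<in> space M. \<forall>i\<in>A \<union> B. X i \<omega> \<in> Z T i}" for T
  define \<T> where "\<T> = {T. T \<subseteq> B \<and> k \<le> card T}"
  define a where "a = (\<Prod>i\<in>A. 1 - exp (- (r i * s)))"
  define b where "b = (\<Prod>i\<in>B. exp (- (r i * s)))"
  have Zb: "Z T i \<in> sets borel" for T i by (simp add: Z_def)
  have Z_prob: "prob {\<omega> \<in> space M. X i \<omega> \<in> Z T i} =
      (if i \<in> A then 1 - exp (- (r i * s))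
       else exp (- (r i * s)) * (if i \<in> T then 1 - exp (- (r i * t)) else exp (- (r i * t))))"
    if "i \<in> A \<union> B" for T i
  proof -
    have i: "i \<in> I" using that AB by auto
    consider "i \<in> A" | "i \<notin> A" "i \<in> T" | "i \<notin> A" "i \<notin> T" by blast
    then show ?thesis
    proof cases
      case 1
      then show ?thesis using prob_X_le[OF i st(1)] by (simp add: Z_def)
    next
      case 2
      then show ?thesis using prob_X_interval[OF i st] by (simp add: Z_def)
    next
      case 3
      then show ?thesis
        using prob_X_gt[OF i, of "s + t"] st by (simp add: Z_def exp_add[symmetric] algebra_simps)
    qed
  qed
  have D_prob: "prob (D T) = a * b *
      ((\<Prod>i\<in>T. 1 - exp (- (r i * t))) * (\<Prod>i\<in>B - T. 1 - (1 - exp (- (r i * t)))))"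
    if T: "T \<subseteq> B" for T
  proof -
    let ?p = "\<lambda>i. prob {\<omega> \<in> space M. X i \<omega> \<in> Z T i}"
    let ?q = "\<lambda>i. if i \<in> T then 1 - exp (- (r i * t)) else exp (- (r i * t))"
    have "prob (D T) = (\<Prod>i\<in>A \<union> B. ?p i)"
      unfolding D_def by (rule prob_all_indep_vars[OF ind fin(3) Zb])
    also have "\<dots> = (\<Prod>i\<in>A. ?p i) * (\<Prod>i\<in>B. ?p i)"
      by (rule prod.union_disjoint) (use fin AB in auto)
    also have "(\<Prod>i\<in>A. ?p i) = a"
      unfolding a_def by (rule prod.cong) (simp_all add: Z_prob)
    also have "(\<Prod>i\<in>B. ?p i) = (\<Prod>i\<in>B. exp (- (r i * s)) * ?q i)"
    proof (rule prod.cong[OF refl])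
      fix i assume "i \<in> B"
      then have "i \<in> A \<union> B" "i \<notin> A" using AB by auto
      then show "?p i = exp (- (r i * s)) * ?q i" by (simp only: Z_prob if_False)
    qed
    also have "\<dots> = b * (\<Prod>i\<in>B. ?q i)" by (simp add: prod.distrib b_def)
    also have "(\<Prod>i\<in>B. ?q i) = (\<Prod>i\<in>T. ?q i) * (\<Prod>i\<in>B - T. ?q i)"
      using prod.subset_diff[OF T fin(2), of ?q] by (simp add: mult.commute)
    also have "(\<Prod>i\<in>T. ?q i) = (\<Prod>i\<in>T. 1 - exp (- (r i * t)))" by (rule prod.cong) auto
    also have "(\<Prod>i\<in>B - T. ?q i) = (\<Prod>i\<in>B - T. 1 - (1 - exp (- (r i * t))))"
      by (rule prod.cong) auto
    finally show ?thesis by (simp only: mult_ac)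
  qed
  have D_iff: "\<omega> \<in> D T \<longleftrightarrow> \<omega> \<in> space M \<and> (\<forall>a\<in>A. X a \<omega> \<le> s) \<and> (\<forall>j\<in>B. s < X j \<omega>)
      \<and> {j \<in> B. X j \<omega> \<le> s + t} = T" if T: "T \<subseteq> B" for T \<omega>
  proof -
    have "(\<forall>i\<in>A \<union> B. X i \<omega> \<in> Z T i) \<longleftrightarrow> (\<forall>i\<in>A. X i \<omega> \<in> Z T i) \<and> (\<forall>i\<in>B. X i \<omega> \<in> Z T i)" by blast
    also have "(\<forall>i\<in>A. X i \<omega> \<in> Z T i) \<longleftrightarrow> (\<forall>a\<in>A. X a \<omega> \<le> s)" by (simp add: Z_def)
    also have "(\<forall>i\<in>B. X i \<omega> \<in> Z T i) \<longleftrightarrow> (\<forall>i\<in>B. s < X i \<omega> \<and> (X i \<omega> \<le> s + t \<longleftrightarrow> i \<in> T))"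
    proof (rule ball_cong[OF refl])
      fix i assume "i \<in> B"
      then have "i \<notin> A" using AB by auto
      then show "X i \<omega> \<in> Z T i \<longleftrightarrow> s < X i \<omega> \<and> (X i \<omega> \<le> s + t \<longleftrightarrow> i \<in> T)"
        using st by (auto simp: Z_def)
    qed
    also have "\<dots> \<longleftrightarrow> (\<forall>j\<in>B. s < X j \<omega>) \<and> {j \<in> B. X j \<omega> \<le> s + t} = T" using T by blast
    finally show ?thesis by (simp add: D_def)
  qed
  have D_event: "D T \<in> events" for T
    unfolding D_def
  proof (intro sets.sets_Collect_finite_All fin)
    fix i assume "i \<in> A \<union> B"
    then have "X i \<in> borel_measurable M" using AB X_measurable by auto
    from measurable_sets[OF this Zb[of T i]]
    show "{\<omega> \<in> space M. X i \<omega> \<in> Z T i} \<in> events" by (simp add: vimage_def Int_def conj_commute)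
  qed
  have fin\<T>: "finite \<T>" using fin by (simp add: \<T>_def)
  have "{\<omega> \<in> space M. (\<forall>a\<in>A. X a \<omega> \<le> s) \<and> (\<forall>j\<in>B. s < X j \<omega>)
      \<and> k \<le> card {j \<in> B. X j \<omega> \<le> s + t}} = (\<Union>T\<in>\<T>. D T)"
    by (auto simp: D_iff \<T>_def)
  moreover have "prob (\<Union>T\<in>\<T>. D T) = (\<Sum>T\<in>\<T>. prob (D T))"
    by (rule finite_measure_finite_Union[OF fin\<T>])
      (use D_event D_iff in \<open>auto simp: disjoint_family_on_def \<T>_def\<close>)
  moreover have "\<dots> = a * b * order_cdf r k B t"
    unfolding order_cdf_def at_least_def sum_distrib_left \<T>_def
    by (rule sum.cong[OF refl]) (simp only: mem_Collect_eq D_prob)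
  moreover have "prob {\<omega> \<in> space M. (\<forall>a\<in>A. X a \<omega> \<le> s) \<and> (\<forall>j\<in>B. s < X j \<omega>)} = a * b"
  proof -
    let ?Z = "\<lambda>i. if i \<in> A then {..s} else {s<..}"
    have "{\<omega> \<in> space M. (\<forall>a\<in>A. X a \<omega> \<le> s) \<and> (\<forall>j\<in>B. s < X j \<omega>)}
        = {\<omega> \<in> space M. \<forall>i\<in>A \<union> B. X i \<omega> \<in> ?Z i}"
      using AB(2) by (auto split: if_splits)
    also have "prob \<dots> = (\<Prod>i\<in>A \<union> B. prob {\<omega> \<in> space M. X i \<omega> \<in> ?Z i})"
      by (rule prob_all_indep_vars[OF ind fin(3)]) simp
    also have "\<dots> = (\<Prod>i\<in>A. prob {\<omega> \<in> space M. X i \<omega> \<in> ?Z i})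
        * (\<Prod>i\<in>B. prob {\<omega> \<in> space M. X i \<omega> \<in> ?Z i})"
      by (rule prod.union_disjoint) (use fin AB in auto)
    also have "(\<Prod>i\<in>A. prob {\<omega> \<in> space M. X i \<omega> \<in> ?Z i}) = a"
      unfolding a_def using AB prob_X_le st by (intro prod.cong) auto
    also have "(\<Prod>i\<in>B. prob {\<omega> \<in> space M. X i \<omega> \<in> ?Z i}) = b"
      unfolding b_def
    proof (rule prod.cong[OF refl])
      fix i assume "i \<in> B"
      then have "i \<in> I" "i \<notin> A" using AB by auto
      then show "prob {\<omega> \<in> space M. X i \<omega> \<in> ?Z i} = exp (- (r i * s))"
        using prob_X_gt[OF _ st(1)] by simp
    qed
    finally show ?thesis .
  qed
  ultimately show ?thesis by simp
qed

end

context independent_exponentials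
begin

text \<open>Lack of memory at the random time \<open>X i\<close>, obtained from \<open>prob_split_at_level\<close> by conditioning on \<open>X i\<close>, which
  is independent of the other items.\<close>

lemma prob_memoryless_block:
  assumes i: "i \<in> I" and AB: "A \<union> B \<subseteq> I - {i}" "A \<inter> B = {}" and t: "0 \<le> t"
  shows "prob {\<omega> \<in> space M. (\<forall>a\<in>A. X a \<omega> \<le> X i \<omega>) \<and> (\<forall>j\<in>B. X i \<omega> < X j \<omega>)
      \<and> k \<le> card {j \<in> B. X j \<omega> \<le> X i \<omega> + t}}
    = prob {\<omega> \<in> space M. (\<forall>a\<in>A. X a \<omega> \<le> X i \<omega>) \<and> (\<forall>j\<in>B. X i \<omega> < X j \<omega>)} * order_cdf r k B t"
proof -
  have sub: "A \<union> B \<subseteq> I" using AB(1) by blast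
  have fin: "finite A" "finite B" using AB(1) finite_I by (auto intro: finite_subset)
  let ?S = "PiM {i} (\<lambda>_. borel :: real measure)" and ?T = "PiM (A \<union> B) (\<lambda>_. borel :: real measure)"
  let ?U = "\<lambda>\<omega>. restrict (\<lambda>l. X l \<omega>) {i}" and ?V = "\<lambda>\<omega>. restrict (\<lambda>l. X l \<omega>) (A \<union> B)"
  define Q where "Q k p \<longleftrightarrow> (\<forall>a\<in>A. snd p a \<le> fst p i) \<and> (\<forall>j\<in>B. fst p i < snd p j)
      \<and> k \<le> card {j \<in> B. snd p j \<le> fst p i + t}"
    for k and p :: "(nat \<Rightarrow> real) \<times> (nat \<Rightarrow> real)"
  define W where "W k = {p \<in> space (?S \<Otimes>\<^sub>M ?T). Q k p}" for k
  \<comment> \<open>The event with \<open>X i\<close> frozen at \<open>\<omega>'\<close>; for \<open>k = 0\<close> the counting condition is void.\<close>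
  define E where "E k \<omega>' \<omega> \<longleftrightarrow> (\<forall>a\<in>A. X a \<omega> \<le> X i \<omega>') \<and> (\<forall>j\<in>B. X i \<omega>' < X j \<omega>)
      \<and> k \<le> card {j \<in> B. X j \<omega> \<le> X i \<omega>' + t}" for k \<omega>' \<omega>
  have fst_meas: "(\<lambda>p. fst p i) \<in> borel_measurable (?S \<Otimes>\<^sub>M ?T)"
    by (rule measurable_compose[OF measurable_fst]) simp
  have snd_meas: "(\<lambda>p. snd p j) \<in> borel_measurable (?S \<Otimes>\<^sub>M ?T)" if "j \<in> A \<union> B" for j
    by (rule measurable_compose[OF measurable_snd]) (use that in simp)
  have W: "W k \<in> sets (?S \<Otimes>\<^sub>M ?T)" for k
  proof -
    have "Measurable.pred (?S \<Otimes>\<^sub>M ?T) (Q k)"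
      unfolding Q_def
    proof (intro pred_intros_logic pred_intros_finite pred_le_card fin)
      show "Measurable.pred (?S \<Otimes>\<^sub>M ?T) (\<lambda>p. snd p a \<le> fst p i)" if "a \<in> A" for a
        unfolding pred_def using that by (intro borel_measurable_le fst_meas snd_meas) auto
      show "Measurable.pred (?S \<Otimes>\<^sub>M ?T) (\<lambda>p. fst p i < snd p j)" if "j \<in> B" for j
        unfolding pred_def using that by (intro borel_measurable_less fst_meas snd_meas) auto
      show "Measurable.pred (?S \<Otimes>\<^sub>M ?T) (\<lambda>p. snd p j \<le> fst p i + t)" if "j \<in> B" for j
        unfolding pred_def using that
        by (intro borel_measurable_le borel_measurable_add fst_meas snd_meas) auto
    qed
    then show ?thesis by (simp add: pred_def W_def)
  qed
  have mem: "(?U \<omega>', ?V \<omega>) \<in> W k \<longleftrightarrow> E k \<omega>' \<omega>" for k \<omega>' \<omega>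
  proof -
    have "{j \<in> B. ?V \<omega> j \<le> ?U \<omega>' i + t} = {j \<in> B. X j \<omega> \<le> X i \<omega>' + t}" by auto
    then show ?thesis
      by (auto simp: W_def Q_def E_def space_pair_measure space_PiM)
  qed
  have ind: "indep_var ?S ?U ?T ?V"
    by (rule indep_var_restrict[OF indep_X]) (use i AB in auto)
  have fubini: "emeasure M {\<omega> \<in> space M. E k \<omega> \<omega>} = (\<integral>\<^sup>+ \<omega>'. emeasure M {\<omega> \<in> space M. E k \<omega>' \<omega>} \<partial>M)"
    and meas: "(\<lambda>\<omega>'. emeasure M {\<omega> \<in> space M. E k \<omega>' \<omega>}) \<in> borel_measurable M" for k
    using emeasure_indep_var_pair[OF ind W[of k]] measurable_emeasure_section[OF ind W[of k]]
    unfolding mem by auto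
  define c where "c = order_cdf r k B t"
  have c: "0 \<le> c"
    unfolding c_def by (rule order_cdf_nonneg) (use rate_pos AB t in auto)
  have "AE \<omega>' in M. emeasure M {\<omega> \<in> space M. E k \<omega>' \<omega>}
      = emeasure M {\<omega> \<in> space M. E 0 \<omega>' \<omega>} * ennreal c"
    using AE_X_pos[OF i]
  proof eventually_elim
    fix \<omega>' assume "0 < X i \<omega>'"
    then have "prob {\<omega> \<in> space M. E k \<omega>' \<omega>} = prob {\<omega> \<in> space M. E 0 \<omega>' \<omega>} * c"
      using prob_split_at_level[OF sub AB(2), of "X i \<omega>'" t k] t by (simp add: E_def c_def)
    then show "emeasure M {\<omega> \<in> space M. E k \<omega>' \<omega>}
        = emeasure M {\<omega> \<in> space M. E 0 \<omega>' \<omega>} * ennreal c"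
      using c by (simp add: emeasure_eq_measure ennreal_mult)
  qed
  then have "(\<integral>\<^sup>+ \<omega>'. emeasure M {\<omega> \<in> space M. E k \<omega>' \<omega>} \<partial>M)
      = (\<integral>\<^sup>+ \<omega>'. emeasure M {\<omega> \<in> space M. E 0 \<omega>' \<omega>} * ennreal c \<partial>M)"
    by (rule nn_integral_cong_AE)
  also have "\<dots> = (\<integral>\<^sup>+ \<omega>'. emeasure M {\<omega> \<in> space M. E 0 \<omega>' \<omega>} \<partial>M) * ennreal c"
    by (rule nn_integral_multc[OF meas])
  finally have "emeasure M {\<omega> \<in> space M. E k \<omega> \<omega>} = emeasure M {\<omega> \<in> space M. E 0 \<omega> \<omega>} * ennreal c"
    unfolding fubini .
  then have "ennreal (prob {\<omega> \<in> space M. E k \<omega> \<omega>}) = ennreal (prob {\<omega> \<in> space M. E 0 \<omega> \<omega>} * c)"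
    using c by (simp add: emeasure_eq_measure ennreal_mult)
  then have "prob {\<omega> \<in> space M. E k \<omega> \<omega>} = prob {\<omega> \<in> space M. E 0 \<omega> \<omega>} * c"
    using c by simp
  then show ?thesis by (simp add: E_def c_def)
qed

end

section \<open>The distribution of a spacing\<close>

locale exponential_sample = independent_exponentials M "{1..n}" X r
  for M :: "'a measure" and n :: nat and X :: "nat \<Rightarrow> 'a \<Rightarrow> real" and r :: "nat \<Rightarrow> real" +
  fixes m k :: nat
  assumes mkn: "1 \<le> m" "m < k" "k \<le> n"
begin

definition spacing :: "'a \<Rightarrow> real" where
  "spacing \<omega> = order_stat n X k \<omega> - order_stat n X m \<omega>"

definition weight :: "nat \<times> nat set \<Rightarrow> real" where
  "weight b = prob {\<omega> \<in> space M. block_event n X b \<omega>}"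

lemma spacing_measurable: "spacing \<in> borel_measurable M"
  unfolding spacing_def[abs_def]
  by (intro borel_measurable_diff measurable_order_stat X_measurable) (use mkn in auto)

lemma spacing_event: "{\<omega> \<in> space M. spacing \<omega> \<le> t} \<in> events"
  using spacing_measurable borel_measurable_iff_le by blast

lemma block_event_measurable:
  assumes "b \<in> blocks n m" shows "{\<omega> \<in> space M. block_event n X b \<omega>} \<in> events"
proof -
  obtain i B where b: "b = (i, B)" by fastforce
  have iB: "i \<in> {1..n}" "B \<subseteq> {1..n}" using assms b by (auto simp: blocks_def)
  have "Measurable.pred M (block_event n X b)"
    unfolding b block_event_def prod.case
  proof (intro pred_intros_logic pred_intros_finite)
    show "finite B" using iB finite_subset by blast
    show "Measurable.pred M (\<lambda>\<omega>. X a \<omega> \<le> X i \<omega>)" if "a \<in> {1..n} - {i} - B" for a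
      unfolding pred_def using that iB by (intro borel_measurable_le X_measurable) auto
    show "Measurable.pred M (\<lambda>\<omega>. X i \<omega> < X j \<omega>)" if "j \<in> B" for j
      unfolding pred_def using that iB by (intro borel_measurable_less X_measurable) auto
  qed simp
  then show ?thesis unfolding pred_def .
qed

lemma AE_ex1_block: "AE \<omega> in M. \<exists>!b. b \<in> blocks n m \<and> block_event n X b \<omega>"
  using AE_X_inj
proof eventually_elim
  case (elim \<omega>)
  then show ?case using mkn by (intro ex1_block) auto
qed

lemma weight_sum: "(\<Sum>b\<in>blocks n m. weight b) = 1"
proof -
  have "prob {\<omega> \<in> space M. True} = (\<Sum>b\<in>blocks n m. weight b)"
    unfolding weight_def
  proof (rule prob_sum[OF finite_blocks block_event_measurable])
    show "AE \<omega> in M. (\<forall>b\<in>blocks n m. block_event n X b \<omega> \<longrightarrow> True) \<and>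
        (True \<longrightarrow> (\<exists>!b\<in>blocks n m. block_event n X b \<omega>))"
      using AE_ex1_block by eventually_elim simp
  qed auto
  then show ?thesis by (simp add: prob_space)
qed

text \<open>Exactly one state at the \<open>m\<close>th failure occurs, almost surely. In the state \<open>(i, B)\<close> the spacing is at most \<open>t\<close>
  iff at least \<open>k - m\<close> items of \<open>B\<close> fail within time \<open>t\<close> after \<open>X i\<close>, and by lack of memory this is
  independent of the state having occurred.\<close>

theorem prob_spacing_le:
  assumes t: "0 \<le> t"
  shows "prob {\<omega> \<in> space M. spacing \<omega> \<le> t}
    = (\<Sum>b\<in>blocks n m. weight b * order_cdf r (k - m) (snd b) t)"
proof -
  have "prob {\<omega> \<in> space M. spacing \<omega> \<le> t}
      = (\<Sum>b\<in>blocks n m. prob {\<omega> \<in> space M. block_event n X b \<omega> \<and> spacing \<omega> \<le> t})"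
  proof (rule prob_sum[OF finite_blocks _ spacing_event])
    fix b assume "b \<in> blocks n m"
    then have "{\<omega> \<in> space M. block_event n X b \<omega>} \<inter> {\<omega> \<in> space M. spacing \<omega> \<le> t} \<in> events"
      by (intro sets.Int block_event_measurable spacing_event)
    moreover have "{\<omega> \<in> space M. block_event n X b \<omega>} \<inter> {\<omega> \<in> space M. spacing \<omega> \<le> t}
        = {\<omega> \<in> space M. block_event n X b \<omega> \<and> spacing \<omega> \<le> t}" by blast
    ultimately show "{\<omega> \<in> space M. block_event n X b \<omega> \<and> spacing \<omega> \<le> t} \<in> events" by simp
  next
    show "AE \<omega> in M. (\<forall>b\<in>blocks n m. block_event n X b \<omega> \<and> spacing \<omega> \<le> t \<longrightarrow> spacing \<omega> \<le> t) \<and>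
        (spacing \<omega> \<le> t \<longrightarrow> (\<exists>!b\<in>blocks n m. block_event n X b \<omega> \<and> spacing \<omega> \<le> t))"
      using AE_ex1_block by eventually_elim simp
  qed
  also have "\<dots> = (\<Sum>b\<in>blocks n m. weight b * order_cdf r (k - m) (snd b) t)"
  proof (rule sum.cong[OF refl])
    fix b assume b: "b \<in> blocks n m"
    obtain i B where iB: "b = (i, B)" by fastforce
    have sub: "i \<in> {1..n}" "B \<subseteq> {1..n} - {i}" using b iB by (auto simp: blocks_def)
    have mn: "1 \<le> m" "m \<le> n" using mkn by auto
    have "block_event n X b \<omega> \<and> spacing \<omega> \<le> t \<longleftrightarrow>
        block_event n X b \<omega> \<and> k - m \<le> card {j \<in> B. X j \<omega> \<le> X i \<omega> + t}" for \<omega>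
      using spacing_block_le_iff[OF mn b[unfolded iB] _ mkn(2,3) t, where X = X and \<omega> = \<omega>] iB by (auto simp: spacing_def)
    then have "prob {\<omega> \<in> space M. block_event n X b \<omega> \<and> spacing \<omega> \<le> t} =
        prob {\<omega> \<in> space M. (\<forall>a\<in>{1..n} - {i} - B. X a \<omega> \<le> X i \<omega>) \<and> (\<forall>j\<in>B. X i \<omega> < X j \<omega>)
          \<and> k - m \<le> card {j \<in> B. X j \<omega> \<le> X i \<omega> + t}}"
      by (simp add: iB block_event_def conj_assoc)
    also have "\<dots> = weight b * order_cdf r (k - m) B t"
      using prob_memoryless_block[OF sub(1) _ _ t, of "{1..n} - {i} - B" B "k - m"] sub(2)
      unfolding weight_def iB block_event_def prod.case by blast
    finally show "prob {\<omega> \<in> space M. block_event n X b \<omega> \<and> spacing \<omega> \<le> t}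
        = weight b * order_cdf r (k - m) (snd b) t" by (simp add: iB)
  qed
  finally show ?thesis .
qed

lemma blocks_snd:
  assumes "b \<in> blocks n m"
  shows "finite (snd b)" "snd b \<subseteq> {1..n}" "card (snd b) = n - m"
proof -
  show sub: "snd b \<subseteq> {1..n}" and "card (snd b) = n - m"
    using assms by (auto simp: blocks_def)
  show "finite (snd b)" using sub by (rule finite_subset) simp
qed

lemma cdf_spacing: "cdf (distr M borel spacing) t = prob {\<omega> \<in> space M. spacing \<omega> \<le> t}"
  using measure_distr[OF spacing_measurable, of "{..t}"]
  by (simp add: cdf_def vimage_def Int_def conj_commute)

text \<open>Positivity of the spacing comes from the mixture formula at \<open>t = 0\<close>.\<close>

lemma prob_spacing_le_0: "prob {\<omega> \<in> space M. spacing \<omega> \<le> 0} = 0"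
proof -
  have "(\<Sum>b\<in>blocks n m. weight b * order_cdf r (k - m) (snd b) 0) = 0"
    by (rule sum.neutral) (use blocks_snd mkn in \<open>auto simp: order_cdf_zero\<close>)
  then show ?thesis using prob_spacing_le[of 0] by simp
qed

lemma AE_spacing_pos: "AE \<omega> in M. 0 < spacing \<omega>"
proof -
  have "AE \<omega> in M. \<not> spacing \<omega> \<le> 0"
    using prob_spacing_le_0 spacing_event
    by (subst AE_iff_measurable[OF _ refl]) (auto simp: emeasure_eq_measure)
  then show ?thesis by (simp add: not_le)
qed

lemma cdf_spacing_homogeneous:
  assumes "\<And>i. i \<in> {1..n} \<Longrightarrow> r i = \<gamma>" and t: "0 \<le> t"
  shows "cdf (distr M borel spacing) t = iid_cdf (n - m) (k - m) (\<gamma> * t)"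
proof -
  have "order_cdf r (k - m) (snd b) t = iid_cdf (n - m) (k - m) (\<gamma> * t)" if b: "b \<in> blocks n m" for b
  proof -
    have "order_cdf r (k - m) (snd b) t = order_cdf (\<lambda>_. \<gamma>) (k - m) (snd b) t"
      unfolding order_cdf_def by (rule at_least_cong) (use assms(1) blocks_snd[OF b] in auto)
    then show ?thesis using order_cdf_const[of "snd b" \<gamma> "k - m" t] blocks_snd[OF b] by simp
  qed
  then show ?thesis
    unfolding cdf_spacing prob_spacing_le[OF t]
    using weight_sum by (simp add: sum_distrib_right[symmetric])
qed

lemma spacing_sizes:
  obtains N K where "n - m = Suc N" "k - m = Suc K" "K \<le> N"
proof
  show "n - m = Suc (n - m - 1)" "k - m = Suc (k - m - 1)" "k - m - 1 \<le> n - m - 1"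
    using mkn by auto
qed

theorem star_below_spacing:
  "star_below (iid_cdf (n - m) (k - m)) (\<lambda>t. \<Sum>b\<in>blocks n m. weight b * order_cdf r (k - m) (snd b) t)"
proof -
  obtain N K where NK: "n - m = Suc N" "k - m = Suc K" "K \<le> N" by (rule spacing_sizes)
  show ?thesis
    unfolding NK(1,2)
  proof (rule star_below_mixture[OF DERIV_iid_cdf iid_density_pos[OF NK(3)] iid_density_sub_multiplicative])
    show "finite (blocks n m)" by (rule finite_blocks)
    show "0 \<le> weight b" for b by (simp add: weight_def)
    show "(\<Sum>b\<in>blocks n m. weight b) = 1" by (rule weight_sum)
    fix b assume b: "b \<in> blocks n m"
    have "star_below (iid_cdf (card (snd b)) (Suc K)) (order_cdf r (Suc K) (snd b))"
      by (rule star_below_order_cdf) (use blocks_snd[OF b] rate_pos NK in auto)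
    then show "star_below (iid_cdf (Suc N) (Suc K)) (order_cdf r (Suc K) (snd b))"
      using blocks_snd[OF b] NK by simp
  qed
qed

end

section \<open>The star order of the spacings\<close>

text \<open>If \<open>G\<close> exceeds at \<open>z\<close> the value of \<open>t \<mapsto> F (\<gamma> * t)\<close> at \<open>y\<close>, then the rate matching \<open>G\<close> at \<open>z\<close> exceeds \<open>\<gamma> * y / z\<close>, so
  \<open>star_below\<close> carries the strict inequality to the pair \<open>x * z / y\<close> and \<open>x\<close>. Hence multiplication by \<open>x / y\<close> maps
  the set defining the right inverse at \<open>y\<close> into the one at \<open>x\<close>.\<close>

lemma star_order_if_star_below:
  fixes F G :: "real \<Rightarrow> real"
  assumes U: "U \<in> borel_measurable M" "AE \<omega> in M. 0 < U \<omega>"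
    and V: "V \<in> borel_measurable N" "AE \<omega> in N. 0 < V \<omega>" and N: "prob_space N"
    and cdfU: "\<And>t. 0 \<le> t \<Longrightarrow> cdf (distr M borel U) t = F (\<gamma> * t)"
    and cdfV: "\<And>t. 0 \<le> t \<Longrightarrow> cdf (distr N borel V) t = G t"
    and zero: "F 0 = 0" "G 0 = 0" and \<gamma>: "0 < \<gamma>"
    and mono: "\<And>a b. 0 \<le> a \<Longrightarrow> a < b \<Longrightarrow> F a < F b"
    and below: "star_below F G"
  shows "star_order M U N V"
  unfolding star_order_def
proof (intro conjI U V mono_onI)
  interpret N: prob_space N by fact
  interpret D: finite_borel_measure "distr N borel V"
    by (intro real_distribution.finite_borel_measure_M N.real_distribution_distr V)
  let ?F = "cdf (distr M borel U)" and ?G = "cdf (distr N borel V)"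
  fix x y :: real assume xy: "x \<in> {0<..}" "y \<in> {0<..}" "x \<le> y"
  have step: "?F x < ?G (x * z / y)" if z: "?F y < ?G z" for z
  proof -
    have Fy: "0 < ?F y" using mono[of 0 "\<gamma> * y"] zero \<gamma> xy by (simp add: cdfU)
    have zpos: "0 < z"
    proof (rule ccontr)
      assume "\<not> 0 < z"
      then have "?G z \<le> ?G 0" by (intro D.cdf_nondecreasing) simp
      then show False using z Fy zero by (simp add: cdfV)
    qed
    obtain a where a: "0 \<le> a" "G z = F (a * z)" "\<And>s. 0 < s \<Longrightarrow> s \<le> z \<Longrightarrow> F (a * s) \<le> G s"
      using star_belowE[OF below zpos] by blast
    have "F (\<gamma> * y) < F (a * z)" using z xy zpos by (simp add: cdfU cdfV a)
    then have "\<gamma> * y < a * z"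
      using mono[of "a * z" "\<gamma> * y"] a zpos by (cases "a * z" "\<gamma> * y" rule: linorder_cases) auto
    then have "\<gamma> * x < a * (x * z / y)" using xy by (simp add: field_simps)
    then have "F (\<gamma> * x) < F (a * (x * z / y))" using \<gamma> xy by (intro mono) auto
    also have "\<dots> \<le> G (x * z / y)" using xy zpos by (intro a) (auto simp: field_simps)
    finally show ?thesis using xy zpos by (simp add: cdfU cdfV)
  qed
  let ?R = "\<lambda>p. right_inverse ?G p"
  have "ereal y * (?R (?F x) / ereal x) \<le> ereal z" if z: "?F y < ?G z" for z
  proof -
    have "?R (?F x) \<le> ereal (x * z / y)"
      unfolding right_inverse_def by (rule INF_lower) (use step[OF z] in simp)
    also have "\<dots> = ereal x * (ereal z / ereal y)" using xy by simp
    finally have "?R (?F x) / ereal x \<le> ereal z / ereal y"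
      using xy by (subst ereal_divide_le_pos) auto
    then show ?thesis using xy by (subst (asm) ereal_le_divide_pos) auto
  qed
  then have "ereal y * (?R (?F x) / ereal x) \<le> ?R (?F y)"
    unfolding right_inverse_def[of _ "?F y"] by (intro INF_greatest) simp
  then show "?R (?F x) / ereal x \<le> ?R (?F y) / ereal y"
    using xy by (subst ereal_le_divide_pos) auto
qed

theorem corollary1:
  fixes M :: "'a measure" and N :: "'b measure"
    and X :: "nat \<Rightarrow> 'a \<Rightarrow> real" and Y :: "nat \<Rightarrow> 'b \<Rightarrow> real"
    and rate :: "nat \<Rightarrow> real" and \<gamma> :: real and m k n :: nat
  assumes "1 \<le> m" and "m < k" and "k \<le> n"
    and "\<And>i. i \<in> {1..n} \<Longrightarrow> 0 < rate i" and "0 < \<gamma>"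
    and "prob_space M" and "prob_space N"
    and "prob_space.indep_vars M (\<lambda>_. borel) X {1..n}"
    and "\<And>i. i \<in> {1..n} \<Longrightarrow> distributed M lborel (X i) (exponential_density (rate i))"
    and "prob_space.indep_vars N (\<lambda>_. borel) Y {1..n}"
    and "\<And>i. i \<in> {1..n} \<Longrightarrow> distributed N lborel (Y i) (exponential_density \<gamma>)"
  shows "star_order
           N (\<lambda>\<omega>. order_stat n Y k \<omega> - order_stat n Y m \<omega>)
           M (\<lambda>\<omega>. order_stat n X k \<omega> - order_stat n X m \<omega>)"
proof -
  interpret X: exponential_sample M n X rate m k
    using assms by (intro exponential_sample.intro independent_exponentials.intro
        independent_exponentials_axioms.intro exponential_sample_axioms.intro) auto
  interpret Y: exponential_sample N n Y "\<lambda>_. \<gamma>" m k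
    using assms by (intro exponential_sample.intro independent_exponentials.intro
        independent_exponentials_axioms.intro exponential_sample_axioms.intro) auto
  let ?F = "iid_cdf (n - m) (k - m)"
  let ?G = "\<lambda>t. \<Sum>b\<in>blocks n m. X.weight b * order_cdf rate (k - m) (snd b) t"
  obtain N' K where NK: "n - m = Suc N'" "k - m = Suc K" "K \<le> N'" by (rule X.spacing_sizes)
  have "star_order N Y.spacing M X.spacing"
  proof (rule star_order_if_star_below[where F = ?F and G = ?G])
    show "Y.spacing \<in> borel_measurable N" "AE \<omega> in N. 0 < Y.spacing \<omega>"
      by (rule Y.spacing_measurable Y.AE_spacing_pos)+
    show "X.spacing \<in> borel_measurable M" "AE \<omega> in M. 0 < X.spacing \<omega>"
      by (rule X.spacing_measurable X.AE_spacing_pos)+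
    show "prob_space M" "0 < \<gamma>" by fact+
    show "cdf (distr N borel Y.spacing) t = ?F (\<gamma> * t)" if "0 \<le> t" for t
      using that by (intro Y.cdf_spacing_homogeneous) auto
    show "cdf (distr M borel X.spacing) t = ?G t" if "0 \<le> t" for t
      using that by (simp add: X.cdf_spacing X.prob_spacing_le)
    show "?F 0 = 0" using assms(2) by (simp add: iid_cdf_def order_cdf_zero)
    show "?G 0 = 0" using X.prob_spacing_le[of 0] X.prob_spacing_le_0 by simp
    show "?F a < ?F b" if "0 \<le> a" "a < b" for a b
      unfolding NK(1,2)
      using DERIV_iid_cdf iid_density_pos[OF NK(3)] that by (rule pos_density_strict_mono)
    show "star_below ?F ?G" by (rule X.star_below_spacing)
  qed
  then show ?thesis unfolding X.spacing_def[abs_def] Y.spacing_def[abs_def] .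
qed

end
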